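(* Let $(\Sigma,G)$ be a geometrically finite hyperbolic surface, let $\alpha>0$ and $M>0$ be real constants, let $\mathcal{G}=3\alpha G$, and let $\Phi:\Sigma\to\mathbb{R}$ be a smooth function. Let $\Delta\subset \mathrm{PSU}(1,1)$ be the uniformizing group of $(\Sigma,G)$ to the disk, let $\pi_{\mathbb{D}}:\mathbb{D}\to\Sigma=\mathbb{D}/\Delta$ be the holomorphic covering map, and let $\tilde\Phi=\Phi\circ\pi_{\mathbb{D}}:\mathbb{D}\to\mathbb{R}$. Let $\mathfrak{I}\subset\mathbb{R}$ be an interval, $t_0\in\mathfrak{I}$, $\varphi_0\in\Sigma$ and $v_0\in T_{\varphi_0}\Sigma$. Let $\varphi:\mathfrak{I}\to\Sigma$ be the smooth solution, with maximal interval of definition $\mathfrak{I}$, of $$\nabla_t\dot\varphi(t)+\frac{1}{M}\sqrt{\frac{3}{2}}\left[\|\dot\varphi(t)\|_{\mathcal{G}}^2+2\Phi(\varphi(t))\right]^{1/2}\dot\varphi(t)+(\mathrm{grad}_{\mathcal{G}}\Phi)(\varphi(t))=0$$ satisfying the initial conditions $\varphi(t_0)=\varphi_0$ and $\dot\varphi(t_0)=v_0$, with $\|\dot\varphi(t)\|_{\mathcal{G}}^2+2\Phi(\varphi(t))>0$ for all $t\in\mathfrak{I}$. Let $\tilde\varphi_0\in\mathbb{D}$ be any point with $\pi_{\mathbb{D}}(\tilde\varphi_0)=\varphi_0$, and let $\tilde v_0\in T_{\tilde\varphi_0}\mathbb{D}$ be the unique tangent vector with $(\mathrm{d}_{\tilde\varphi_0}\pi_{\mathbb{D}})(\tilde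 v_0)=v_0$. Then $\varphi$ can be written as $\varphi=\pi_{\mathbb{D}}\circ\tilde\varphi$, where $\tilde\varphi:\mathfrak{I}\to\mathbb{D}$ is a solution of the equation $$\nabla_t\dot{\tilde\varphi}(t)+\frac{1}{M}\sqrt{\frac{3}{2}}\left[3\alpha\|\dot{\tilde\varphi}(t)\|_{\mathbb{D}}^2+2\tilde\Phi(\tilde\varphi(t))\right]^{1/2}\dot{\tilde\varphi}(t)+\frac{1}{3\alpha}(\mathrm{grad}_{\mathbb{D}}\tilde\Phi)(\tilde\varphi(t))=0$$ which satisfies the initial conditions $\tilde\varphi(t_0)=\tilde\varphi_0$ and $\dot{\tilde\varphi}(t_0)=\tilde v_0$.
   Context: All surfaces are smooth, connected, oriented, paracompact and without boundary. A hyperbolic surface $(\Sigma,G)$ is such a surface $\Sigma$ endowed with a complete Riemannian metric $G$ of constant Gaussian curvature $-1$; it is called geometrically finite if $\pi_1(\Sigma)$ is finitely generated. $\mathbb{D}=\{u\in\mathbb{C}: |u|<1\}$ is the open unit disk endowed with the Poincaré metric $G_{\mathbb{D}}$, given by $\mathrm{d}s^2_{\mathbb{D}}=\frac{4}{(1-|u|^2)^2}|\mathrm{d}u|^2$. The group $\mathrm{PSU}(1,1)$ acts on $\mathbb{D}$ as the group of orientation-preserving isometries by $u\mapsto\frac{\eta u+\sigma}{\bar\sigma u+\bar\eta}$ with $|\eta|^2-|\sigma|^2=1$. The uniformizing group $\Delta$ of $(\Sigma,G)$ is a discrete subgroup of $\mathrm{PSU}(1,1)$ without elliptic elements such that $(\Sigma,G)$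 is isometric with $\mathbb{D}/\Delta$ endowed with the quotient of the Poincaré metric. The covering map $\pi_{\mathbb{D}}:\mathbb{D}\to\Sigma$ is the quotient projection; it is a universal covering map which is holomorphic (for the complex structure on $\Sigma$ determined by the conformal class of $G$ and the orientation) and a local isometry from $(\mathbb{D},G_{\mathbb{D}})$ to $(\Sigma,G)$. $\|\cdot\|_{\mathcal{G}}$ and $\|\cdot\|_{\mathbb{D}}$ denote the norms on tangent vectors induced by $\mathcal{G}$ and $G_{\mathbb{D}}$ respectively; $\mathrm{grad}_{\mathcal{G}}$ and $\mathrm{grad}_{\mathbb{D}}$ denote the gradients with respect to $\mathcal{G}$ and $G_{\mathbb{D}}$. A dot denotes $\frac{\mathrm{d}}{\mathrm{d}t}$, and $\nabla_t$ denotes the covariant derivative along the curve with respect to the Levi-Civita connection (of $\mathcal{G}$ for curves in $\Sigma$, of $G_{\mathbb{D}}$ for curves in $\mathbb{D}$). *)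

theory Defs
  imports
    "HOL-Analysis.Analysis"
    "HOL-Algebra.Bij"
    "HOL-Algebra.Generated_Groups"
begin

section \<open>Smooth functions and curves\<close>

text \<open>Intended for open \<open>U\<close>: all iterated directional derivatives exist, are differentiable and
  continuous up to order \<open>k\<close>.\<close>

primrec Ck_on :: "nat \<Rightarrow> ('a::real_normed_vector \<Rightarrow> 'b::real_normed_vector) \<Rightarrow> 'a set \<Rightarrow> bool" where
  "Ck_on 0 f U \<longleftrightarrow> continuous_on U f"
| "Ck_on (Suc k) f U \<longleftrightarrow>
     f differentiable_on U \<and> (\<forall>v. Ck_on k (\<lambda>x. frechet_derivative f (at x) v) U)"

definition smooth_on :: "('a::real_normed_vector \<Rightarrow> 'b::real_normed_vector) \<Rightarrow> 'a set \<Rightarrow> bool" where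
  "smooth_on f U \<longleftrightarrow> (\<forall>k. Ck_on k f U)"

text \<open>Intended for relatively open subsets \<open>J\<close> of a nondegenerate interval; derivatives are taken
  within \<open>J\<close>, hence one-sided at an endpoint belonging to \<open>J\<close>.\<close>

primrec Ck_curve :: "nat \<Rightarrow> (real \<Rightarrow> 'b::real_normed_vector) \<Rightarrow> real set \<Rightarrow> bool" where
  "Ck_curve 0 f J \<longleftrightarrow> continuous_on J f"
| "Ck_curve (Suc k) f J \<longleftrightarrow>
     f differentiable_on J \<and> Ck_curve k (\<lambda>t. vector_derivative f (at t within J)) J"

definition nondegenerate_interval :: "real set \<Rightarrow> bool" where
  "nondegenerate_interval I \<longleftrightarrow> is_interval I \<and> interior I \<noteq> {}"


section \<open>Oriented smooth surfaces\<close>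

text \<open>A surface is a subset \<open>S\<close> of a topological space, with the subspace topology, together with an
  (not necessarily maximal) oriented smooth atlas. Charts take values in \<open>\<complex>\<close>, used as
  the oriented real plane with oriented basis \<open>1, \<i>\<close>.\<close>

type_synonym 'a chart = "'a set \<times> ('a \<Rightarrow> complex)"

abbreviation chart_image :: "'a chart \<Rightarrow> complex set" where
  "chart_image c \<equiv> snd c ` fst c"

abbreviation chart_inv :: "'a chart \<Rightarrow> complex \<Rightarrow> 'a" where
  "chart_inv c \<equiv> inv_into (fst c) (snd c)"

definition transition :: "'a chart \<Rightarrow> 'a chart \<Rightarrow> complex \<Rightarrow> complex" where
  "transition c d x = snd d (chart_inv c x)"

definition charts_at :: "'a chart set \<Rightarrow> 'a \<Rightarrow> 'a chart set" where
  "charts_at A p = {c \<in> A. p \<in> fst c}"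

definition some_chart :: "'a chart set \<Rightarrow> 'a \<Rightarrow> 'a chart" where
  "some_chart A p = (SOME c. c \<in> charts_at A p)"

definition paracompact_space :: "'a topology \<Rightarrow> bool" where
  "paracompact_space X \<longleftrightarrow>
     (\<forall>\<U>. (\<forall>U\<in>\<U>. openin X U) \<and> \<Union>\<U> = topspace X \<longrightarrow>
       (\<exists>\<V>. (\<forall>V\<in>\<V>. openin X V \<and> (\<exists>U\<in>\<U>. V \<subseteq> U)) \<and> \<Union>\<V> = topspace X \<and> locally_finite_in X \<V>))"

text \<open>\<open>Im (cnj a * b)\<close> is the determinant of the pair \<open>(a, b)\<close> of plane vectors.\<close>

definition oriented_atlas :: "'a::topological_space set \<Rightarrow> 'a chart set \<Rightarrow> bool" where
  "oriented_atlas S A \<longleftrightarrow>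
     \<Union>(fst ` A) = S \<and>
     (\<forall>c\<in>A. openin (top_of_set S) (fst c) \<and> open (chart_image c) \<and>
        homeomorphism (fst c) (chart_image c) (snd c) (chart_inv c)) \<and>
     (\<forall>c\<in>A. \<forall>d\<in>A. smooth_on (transition c d) (snd c ` (fst c \<inter> fst d)) \<and>
        (\<forall>x \<in> snd c ` (fst c \<inter> fst d).
           Im (cnj (frechet_derivative (transition c d) (at x) 1) *
               frechet_derivative (transition c d) (at x) \<i>) > 0))"

definition surface :: "'a::topological_space set \<Rightarrow> 'a chart set \<Rightarrow> bool" where
  "surface S A \<longleftrightarrow> connected S \<and> Hausdorff_space (top_of_set S) \<and>
     paracompact_space (top_of_set S) \<and> oriented_atlas S A"


section \<open>Tangent vectors and differentials\<close>

text \<open>A tangent vector at \<open>p\<close> is the family of its component vectors in all charts around \<open>p\<close>,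
  related by the derivatives of the transition maps; it is set to \<open>0\<close> on all other charts.\<close>

type_synonym 'a tvec = "'a chart \<Rightarrow> complex"

definition tspace :: "'a chart set \<Rightarrow> 'a \<Rightarrow> 'a tvec set" where
  "tspace A p = {v. (\<forall>c. c \<notin> charts_at A p \<longrightarrow> v c = 0) \<and>
     (\<forall>c\<in>charts_at A p. \<forall>d\<in>charts_at A p.
        v d = frechet_derivative (transition c d) (at (snd c p)) (v c))}"

definition coord_vec :: "'a chart set \<Rightarrow> 'a chart \<Rightarrow> 'a \<Rightarrow> complex \<Rightarrow> 'a tvec" where
  "coord_vec A c p e = (\<lambda>d. if d \<in> charts_at A p
     then frechet_derivative (transition c d) (at (snd c p)) e else 0)"

definition smooth_fun :: "'a chart set \<Rightarrow> ('a \<Rightarrow> real) \<Rightarrow> bool" where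
  "smooth_fun A F \<longleftrightarrow> (\<forall>c\<in>A. smooth_on (\<lambda>x. F (chart_inv c x)) (chart_image c))"

definition fun_diff :: "'a chart set \<Rightarrow> ('a \<Rightarrow> real) \<Rightarrow> 'a \<Rightarrow> 'a tvec \<Rightarrow> real" where
  "fun_diff A F p v = (let c = some_chart A p in
     frechet_derivative (\<lambda>x. F (chart_inv c x)) (at (snd c p)) (v c))"

definition smooth_map :: "'a::topological_space set \<Rightarrow> 'a chart set \<Rightarrow>
    'b::topological_space set \<Rightarrow> 'b chart set \<Rightarrow> ('a \<Rightarrow> 'b) \<Rightarrow> bool" where
  "smooth_map S A T B f \<longleftrightarrow> continuous_on S f \<and> f ` S \<subseteq> T \<and>
     (\<forall>c\<in>A. \<forall>d\<in>B. smooth_on (\<lambda>x. snd d (f (chart_inv c x))) (snd c ` (fst c \<inter> f -` fst d)))"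

definition map_diff :: "'a chart set \<Rightarrow> 'b chart set \<Rightarrow> ('a \<Rightarrow> 'b) \<Rightarrow> 'a \<Rightarrow> 'a tvec \<Rightarrow> 'b tvec" where
  "map_diff A B f p v = (\<lambda>d. if d \<in> charts_at B (f p)
     then (let c = some_chart A p in
       frechet_derivative (\<lambda>x. snd d (f (chart_inv c x))) (at (snd c p)) (v c))
     else 0)"

definition smooth_curve :: "'a::topological_space set \<Rightarrow> 'a chart set \<Rightarrow> real set \<Rightarrow> (real \<Rightarrow> 'a) \<Rightarrow> bool" where
  "smooth_curve S A I \<phi> \<longleftrightarrow> continuous_on I \<phi> \<and> \<phi> ` I \<subseteq> S \<and>
     (\<forall>c\<in>A. \<forall>k. Ck_curve k (\<lambda>t. snd c (\<phi> t)) {t \<in> I. \<phi> t \<in> fst c})"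

definition velocity :: "'a chart set \<Rightarrow> real set \<Rightarrow> (real \<Rightarrow> 'a) \<Rightarrow> real \<Rightarrow> 'a tvec" where
  "velocity A I \<phi> t = (\<lambda>c. if c \<in> charts_at A (\<phi> t)
     then vector_derivative (\<lambda>s. snd c (\<phi> s)) (at t within I) else 0)"


section \<open>Riemannian metrics\<close>

type_synonym 'a metric = "'a \<Rightarrow> 'a tvec \<Rightarrow> 'a tvec \<Rightarrow> real"

definition metric_coeff :: "'a chart set \<Rightarrow> 'a metric \<Rightarrow> 'a chart \<Rightarrow> complex \<Rightarrow> complex \<Rightarrow> complex \<Rightarrow> real" where
  "metric_coeff A g c x e f =
     g (chart_inv c x) (coord_vec A c (chart_inv c x) e) (coord_vec A c (chart_inv c x) f)"

definition riemannian_metric :: "'a set \<Rightarrow> 'a chart set \<Rightarrow> 'a metric \<Rightarrow> bool" where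
  "riemannian_metric S A g \<longleftrightarrow>
     (\<forall>p\<in>S. \<forall>v\<in>tspace A p. \<forall>w\<in>tspace A p.
        g p v w = g p w v \<and>
        (\<forall>z\<in>tspace A p. \<forall>a b. g p (\<lambda>c. a *\<^sub>R v c + b *\<^sub>R w c) z = a * g p v z + b * g p w z) \<and>
        (v \<noteq> (\<lambda>_. 0) \<longrightarrow> g p v v > 0)) \<and>
     (\<forall>c\<in>A. \<forall>e f. smooth_on (\<lambda>x. metric_coeff A g c x e f) (chart_image c))"

definition tnorm :: "'a metric \<Rightarrow> 'a \<Rightarrow> 'a tvec \<Rightarrow> real" where
  "tnorm g p v = sqrt (g p v v)"

definition grad :: "'a chart set \<Rightarrow> 'a metric \<Rightarrow> ('a \<Rightarrow> real) \<Rightarrow> 'a \<Rightarrow> 'a tvec" where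
  "grad A g F p = (THE w. w \<in> tspace A p \<and> (\<forall>h\<in>tspace A p. g p w h = fun_diff A F p h))"

text \<open>Levi-Civita connection in a chart: \<open>christoffel A g c x e f\<close> is the coordinate expression of
  \<open>\<nabla>\<^sub>E F\<close> for the constant coordinate fields \<open>E\<close>, \<open>F\<close> with components \<open>e\<close>, \<open>f\<close>,
  determined by the Koszul formula.\<close>

definition christoffel ::
    "'a chart set \<Rightarrow> 'a metric \<Rightarrow> 'a chart \<Rightarrow> complex \<Rightarrow> complex \<Rightarrow> complex \<Rightarrow> complex" where
  "christoffel A g c x e f = (THE w. \<forall>h. 2 * metric_coeff A g c x w h =
       frechet_derivative (\<lambda>y. metric_coeff A g c y f h) (at x) e
     + frechet_derivative (\<lambda>y. metric_coeff A g c y e h) (at x) f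
     - frechet_derivative (\<lambda>y. metric_coeff A g c y e f) (at x) h)"

text \<open>Covariant derivative of the vector field \<open>V\<close> along the curve \<open>\<phi>\<close>.\<close>

definition cov_deriv :: "'a chart set \<Rightarrow> 'a metric \<Rightarrow> real set \<Rightarrow> (real \<Rightarrow> 'a) \<Rightarrow> (real \<Rightarrow> 'a tvec) \<Rightarrow>
    real \<Rightarrow> 'a tvec" where
  "cov_deriv A g I \<phi> V t = (\<lambda>c. if c \<in> charts_at A (\<phi> t)
     then vector_derivative (\<lambda>s. V s c) (at t within I)
        + christoffel A g c (snd c (\<phi> t)) (velocity A I \<phi> t c) (V t c)
     else 0)"

text \<open>Components of \<open>R(E,F)H = \<nabla>\<^sub>E \<nabla>\<^sub>F H - \<nabla>\<^sub>F \<nabla>\<^sub>E H\<close> for constant coordinate fields.\<close>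

definition riemann_tensor ::
    "'a chart set \<Rightarrow> 'a metric \<Rightarrow> 'a chart \<Rightarrow> complex \<Rightarrow> complex \<Rightarrow> complex \<Rightarrow> complex \<Rightarrow> complex" where
  "riemann_tensor A g c x e f h =
       frechet_derivative (\<lambda>y. christoffel A g c y f h) (at x) e
     - frechet_derivative (\<lambda>y. christoffel A g c y e h) (at x) f
     + christoffel A g c x e (christoffel A g c x f h)
     - christoffel A g c x f (christoffel A g c x e h)"

definition gauss_curvature :: "'a chart set \<Rightarrow> 'a metric \<Rightarrow> 'a \<Rightarrow> real" where
  "gauss_curvature A g p = (let c = some_chart A p; x = snd c p; G = metric_coeff A g c x in
     G (riemann_tensor A g c x 1 \<i> \<i>) 1 / (G 1 1 * G \<i> \<i> - (G 1 \<i>)\<^sup>2))"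

definition geodesically_complete :: "'a::topological_space set \<Rightarrow> 'a chart set \<Rightarrow> 'a metric \<Rightarrow> bool" where
  "geodesically_complete S A g \<longleftrightarrow> (\<forall>p\<in>S. \<forall>v\<in>tspace A p. \<exists>\<gamma>.
     smooth_curve S A UNIV \<gamma> \<and> \<gamma> 0 = p \<and> velocity A UNIV \<gamma> 0 = v \<and>
     (\<forall>t. cov_deriv A g UNIV \<gamma> (velocity A UNIV \<gamma>) t = (\<lambda>_. 0)))"


section \<open>Hyperbolic surfaces\<close>

definition hyperbolic_surface :: "'a::topological_space set \<Rightarrow> 'a chart set \<Rightarrow> 'a metric \<Rightarrow> bool" where
  "hyperbolic_surface S A g \<longleftrightarrow> surface S A \<and> riemannian_metric S A g \<and>
     geodesically_complete S A g \<and> (\<forall>p\<in>S. gauss_curvature A g p = -1)"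

definition path_class :: "'a::topological_space set \<Rightarrow> (real \<Rightarrow> 'a) \<Rightarrow> (real \<Rightarrow> 'a) set" where
  "path_class S p = {q. homotopic_paths S p q}"

definition fundamental_group :: "'a::topological_space set \<Rightarrow> 'a \<Rightarrow> (real \<Rightarrow> 'a) set monoid" where
  "fundamental_group S x =
     \<lparr>carrier = path_class S ` {p. path p \<and> path_image p \<subseteq> S \<and> pathstart p = x \<and> pathfinish p = x},
      mult = (\<lambda>P Q. path_class S ((SOME p. p \<in> P) +++ (SOME q. q \<in> Q))),
      one = path_class S (\<lambda>_. x)\<rparr>"

definition finitely_generated_group :: "('g, 'm) monoid_scheme \<Rightarrow> bool" where
  "finitely_generated_group \<Gamma> \<longleftrightarrow>
     (\<exists>B. finite B \<and> B \<subseteq> carrier \<Gamma> \<and> generate \<Gamma> B = carrier \<Gamma>)"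

definition geometrically_finite :: "'a::topological_space set \<Rightarrow> bool" where
  "geometrically_finite S \<longleftrightarrow> (\<forall>x\<in>S. finitely_generated_group (fundamental_group S x))"


section \<open>The Poincare disk and its isometry group\<close>

abbreviation disk :: "complex set" where
  "disk \<equiv> ball 0 1"

definition disk_chart :: "complex chart" where
  "disk_chart = (disk, \<lambda>u. u)"

definition disk_atlas :: "complex chart set" where
  "disk_atlas = {disk_chart}"

definition poincare_metric :: "complex metric" where
  "poincare_metric u v w = 4 / (1 - (cmod u)\<^sup>2)\<^sup>2 * (v disk_chart \<bullet> w disk_chart)"

text \<open>\<open>PSU(1,1) = SU(1,1)/{1,-1}\<close> acts faithfully on the disk and is identified with the group of
  the resulting transformations.\<close>

definition mobius :: "complex \<Rightarrow> complex \<Rightarrow> complex \<Rightarrow> complex" where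
  "mobius \<eta> \<sigma> = restrict (\<lambda>u. (\<eta> * u + \<sigma>) / (cnj \<sigma> * u + cnj \<eta>)) disk"

definition PSU11 :: "(complex \<Rightarrow> complex) monoid" where
  "PSU11 = (BijGroup disk)
     \<lparr>carrier := {mobius \<eta> \<sigma> | \<eta> \<sigma>. (cmod \<eta>)\<^sup>2 - (cmod \<sigma>)\<^sup>2 = 1}\<rparr>"

text \<open>A subgroup of \<open>PSU(1,1)\<close> is discrete iff its preimage in \<open>SU(1,1)\<close>, here regarded as a subset
  of \<open>\<complex>\<^sup>2\<close>, is discrete, since the quotient map has finite kernel.\<close>

definition discrete_in_PSU11 :: "(complex \<Rightarrow> complex) set \<Rightarrow> bool" where
  "discrete_in_PSU11 \<Delta> \<longleftrightarrow>
     discrete {(\<eta>, \<sigma>). (cmod \<eta>)\<^sup>2 - (cmod \<sigma>)\<^sup>2 = 1 \<and> mobius \<eta> \<sigma> \<in> \<Delta>}"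

text \<open>Elliptic means that the trace \<open>2 Re \<eta>\<close> has absolute value less than \<open>2\<close>.\<close>

definition elliptic :: "(complex \<Rightarrow> complex) \<Rightarrow> bool" where
  "elliptic \<gamma> \<longleftrightarrow> (\<exists>\<eta> \<sigma>. (cmod \<eta>)\<^sup>2 - (cmod \<sigma>)\<^sup>2 = 1 \<and> \<gamma> = mobius \<eta> \<sigma> \<and> \<bar>2 * Re \<eta>\<bar> < 2)"


section \<open>Uniformization\<close>

definition pos_oriented :: "'a chart set \<Rightarrow> 'a \<Rightarrow> 'a tvec \<Rightarrow> 'a tvec \<Rightarrow> bool" where
  "pos_oriented A p v w \<longleftrightarrow> (\<forall>c\<in>charts_at A p. Im (cnj (v c) * w c) > 0)"

text \<open>The (almost) complex structure determined by the conformal class of \<open>g\<close> and the orientation: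
  rotation by a right angle in the positive sense.\<close>

definition complex_structure :: "'a chart set \<Rightarrow> 'a metric \<Rightarrow> 'a \<Rightarrow> 'a tvec \<Rightarrow> 'a tvec" where
  "complex_structure A g p v = (THE w. w \<in> tspace A p \<and> g p v w = 0 \<and> g p w w = g p v v \<and>
     (v \<noteq> (\<lambda>_. 0) \<longrightarrow> pos_oriented A p v w))"

definition holomorphic_map :: "'a::topological_space set \<Rightarrow> 'a chart set \<Rightarrow> 'a metric \<Rightarrow>
    'b::topological_space set \<Rightarrow> 'b chart set \<Rightarrow> 'b metric \<Rightarrow> ('a \<Rightarrow> 'b) \<Rightarrow> bool" where
  "holomorphic_map S A g T B h f \<longleftrightarrow> smooth_map S A T B f \<and>
     (\<forall>p\<in>S. \<forall>v\<in>tspace A p. map_diff A B f p (complex_structure A g p v) =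
        complex_structure B h (f p) (map_diff A B f p v))"

definition local_isometry :: "'a::topological_space set \<Rightarrow> 'a chart set \<Rightarrow> 'a metric \<Rightarrow>
    'b::topological_space set \<Rightarrow> 'b chart set \<Rightarrow> 'b metric \<Rightarrow> ('a \<Rightarrow> 'b) \<Rightarrow> bool" where
  "local_isometry S A g T B h f \<longleftrightarrow> smooth_map S A T B f \<and>
     (\<forall>p\<in>S. \<forall>v\<in>tspace A p. \<forall>w\<in>tspace A p.
        h (f p) (map_diff A B f p v) (map_diff A B f p w) = g p v w)"

text \<open>\<open>\<Delta>\<close> is a uniformizing group of \<open>(S,g)\<close>, with \<open>\<pi>\<close> the quotient projection onto
  \<open>S = \<bbbD>/\<Delta>\<close>: the fibres of \<open>\<pi>\<close> are the \<open>\<Delta>\<close>-orbits, and the quotient metric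
  corresponds to \<open>g\<close> since \<open>\<pi>\<close> is a local isometry.\<close>

definition uniformization :: "'a::topological_space set \<Rightarrow> 'a chart set \<Rightarrow> 'a metric \<Rightarrow>
    (complex \<Rightarrow> complex) set \<Rightarrow> (complex \<Rightarrow> 'a) \<Rightarrow> bool" where
  "uniformization S A g \<Delta> \<pi> \<longleftrightarrow>
     subgroup \<Delta> PSU11 \<and> discrete_in_PSU11 \<Delta> \<and> (\<forall>\<gamma>\<in>\<Delta>. \<not> elliptic \<gamma>) \<and>
     covering_space disk \<pi> S \<and>
     (\<forall>u\<in>disk. \<forall>w\<in>disk. \<pi> u = \<pi> w \<longleftrightarrow> (\<exists>\<gamma>\<in>\<Delta>. w = \<gamma> u)) \<and>
     holomorphic_map disk disk_atlas poincare_metric S A g \<pi> \<and>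
     local_isometry disk disk_atlas poincare_metric S A g \<pi>"


section \<open>The cosmological equation\<close>

text \<open>The square root forces the radicand to be nonnegative; the equation is posed on the region
  where it is positive, and this is made part of the notion of solution.\<close>

definition cosmological_solution :: "'a::topological_space set \<Rightarrow> 'a chart set \<Rightarrow> 'a metric \<Rightarrow>
    real \<Rightarrow> ('a \<Rightarrow> real) \<Rightarrow> real set \<Rightarrow> (real \<Rightarrow> 'a) \<Rightarrow> bool" where
  "cosmological_solution S A g M F I \<phi> \<longleftrightarrow>
     nondegenerate_interval I \<and> smooth_curve S A I \<phi> \<and>
     (\<forall>t\<in>I. (tnorm g (\<phi> t) (velocity A I \<phi> t))\<^sup>2 + 2 * F (\<phi> t) > 0) \<and>
     (\<forall>t\<in>I. \<forall>c.
        cov_deriv A g I \<phi> (velocity A I \<phi>) t c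
        + (1 / M * sqrt (3 / 2) *
             sqrt ((tnorm g (\<phi> t) (velocity A I \<phi> t))\<^sup>2 + 2 * F (\<phi> t))) *\<^sub>R velocity A I \<phi> t c
        + grad A g F (\<phi> t) c = 0)"

definition maximal_cosmological_solution :: "'a::topological_space set \<Rightarrow> 'a chart set \<Rightarrow> 'a metric \<Rightarrow>
    real \<Rightarrow> ('a \<Rightarrow> real) \<Rightarrow> real set \<Rightarrow> (real \<Rightarrow> 'a) \<Rightarrow> bool" where
  "maximal_cosmological_solution S A g M F I \<phi> \<longleftrightarrow>
     cosmological_solution S A g M F I \<phi> \<and>
     (\<forall>J \<psi>. cosmological_solution S A g M F J \<psi> \<and> I \<subseteq> J \<and> (\<forall>t\<in>I. \<psi> t = \<phi> t) \<longrightarrow> J = I)"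

end

theory Submission
  imports Defs
begin

text \<open>The solution \<open>\<phi>\<close> lifts through the covering \<open>\<pi>\<close> because its domain is an interval, and the lift
  \<open>\<psi>\<close> is smooth because \<open>\<pi>\<close> is a local diffeomorphism. As \<open>\<pi>\<close> multiplies the metric by the constant
  \<open>\<kappa> = 3 \<alpha>\<close> when measured with \<open>\<G>\<close>, it intertwines the Levi-Civita connections (which do not see
  \<open>\<kappa>\<close>) and takes \<open>1 / \<kappa>\<close> times the gradient of \<open>\<Phi> \<circ> \<pi>\<close> to the gradient of \<open>\<Phi>\<close>. So the
  differential of \<open>\<pi>\<close> maps the left-hand side of the lifted equation to that of the original one, and
  it is injective.\<close>

section \<open>Lifting along a covering space\<close>

text \<open>No local inverse of \<open>\<pi>\<close> is ever formed. First-order differentiability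
  of the lift follows from its continuity and the differentiability of \<open>\<phi>\<close>,
  because the differential of \<open>\<pi>\<close> has a left inverse; all higher orders follow from
  a formula that gives \<open>\<psi>'\<close> in terms of \<open>\<psi>\<close> and the velocity of
  \<open>\<phi>\<close>. Both arguments work with derivatives within a set, as endpoints of the
  interval require. Gradients and Christoffel symbols are definite descriptions, so each must first
  be shown to exist uniquely. The metric on \<open>S\<close> is evaluated on images of disk vectors;
  these exhaust each tangent plane, so symmetry, bilinearity and nondegeneracy carry over from the
  disk. In coordinates the connections correspond only up to an inhomogeneous term: differentiating
  the metric coefficients along \<open>\<pi>\<close> produces second derivatives of its local
  expression. Symmetry of second derivatives collapses them to a single term in the Koszul formula,
  and this is the term that the product rule creates when the image of \<open>\<psi>'\<close> is
  differentiated in time.\<close>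

lemma covering_space_pullback:
  fixes p :: "'a::topological_space \<Rightarrow> 'b::topological_space"
    and f :: "'c::topological_space \<Rightarrow> 'b"
  assumes cov: "covering_space C p S" and f: "continuous_on U f" "f \<in> U \<rightarrow> S"
  shows "covering_space {(t, u). t \<in> U \<and> u \<in> C \<and> f t = p u} fst U"
proof
  let ?E = "{(t, u). t \<in> U \<and> u \<in> C \<and> f t = p u}"
  show "continuous_on ?E fst"
    by (intro continuous_intros)
  have "p ` C = S"
    using cov by (rule covering_space_imp_surjective)
  then show "fst ` ?E = U"
    using f(2) by (force simp: image_iff)
  fix t assume t: "t \<in> U"
  then have "f t \<in> S"
    using f(2) by blast
  then obtain T \<V> where T: "f t \<in> T" "openin (top_of_set S) T"
    and \<V>: "\<Union>\<V> = C \<inter> p -` T" "\<forall>V\<in>\<V>. openin (top_of_set C) V" "pairwise disjnt \<V>"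
      "\<forall>V\<in>\<V>. \<exists>q. homeomorphism V T p q"
    using cov unfolding covering_space_def by meson
  \<comment> \<open>Over the preimage \<open>?T\<close> of an evenly covered \<open>T\<close>, the
    sheet belonging to \<open>V\<close> is the graph of \<open>q \<circ> f\<close>, where
    \<open>q\<close> inverts \<open>p\<close> on \<open>V\<close>; hence \<open>fst\<close> is a
    homeomorphism from it onto \<open>?T\<close>.\<close>
  let ?T = "U \<inter> f -` T" and ?v = "\<lambda>V. (U \<times> V) \<inter> ?E"
  have sub: "V \<subseteq> C" "p ` V \<subseteq> T" if "V \<in> \<V>" for V
    using that \<V>(1) by auto
  show "\<exists>T. t \<in> T \<and> openin (top_of_set U) T \<and>
      (\<exists>v. \<Union>v = ?E \<inter> fst -` T \<and> (\<forall>u\<in>v. openin (top_of_set ?E) u) \<and> pairwise disjnt v \<and>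
        (\<forall>u\<in>v. \<exists>q. homeomorphism u T fst q))"
  proof (intro exI[of _ ?T] exI[of _ "?v ` \<V>"] conjI ballI)
    show "t \<in> ?T"
      using t T by simp
    show "openin (top_of_set U) ?T"
      using continuous_openin_preimage[OF f] T(2) by blast
    show "\<Union>(?v ` \<V>) = ?E \<inter> fst -` ?T"
    proof -
      have "\<Union>(?v ` \<V>) = (U \<times> \<Union>\<V>) \<inter> ?E"
        by blast
      also have "\<dots> = ?E \<inter> fst -` ?T"
        unfolding \<V>(1) by auto
      finally show ?thesis .
    qed
    show "pairwise disjnt (?v ` \<V>)"
    proof (rule pairwise_imageI)
      fix V V' assume "V \<in> \<V>" "V' \<in> \<V>" "V \<noteq> V'"
      then have "V \<inter> V' = {}"
        using \<V>(3) by (auto simp: pairwise_def disjnt_def)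
      then show "disjnt (?v V) (?v V')"
        unfolding disjnt_def by blast
    qed
  next
    fix W assume "W \<in> ?v ` \<V>"
    then obtain V where V: "V \<in> \<V>" and W: "W = ?v V"
      by auto
    show "openin (top_of_set ?E) W"
    proof -
      obtain Q where Q: "open Q" "V = C \<inter> Q"
        using \<V>(2) V by (auto simp: openin_open)
      have "W = ?E \<inter> UNIV \<times> Q"
        unfolding W Q(2) by auto
      then show ?thesis
        using Q(1) by (auto intro!: openin_open_Int open_Times)
    qed
    obtain q where q: "homeomorphism V T p q"
      using \<V>(4) V by blast
    have "homeomorphism W ?T fst (\<lambda>s. (s, q (f s)))"
    proof
      have qV: "q (f s) \<in> V" "p (q (f s)) = f s" if "s \<in> ?T" for s
        using q that by (auto simp: homeomorphism_def)
      have qp: "q (p u) = u" if "u \<in> V" for u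
        using q that by (auto simp: homeomorphism_def)
      show "continuous_on W fst"
        by (intro continuous_intros)
      show "continuous_on ?T (\<lambda>s. (s, q (f s)))"
      proof (rule continuous_on_Pair)
        have "continuous_on T q" "continuous_on ?T f"
          using q f(1) by (auto simp: homeomorphism_def intro: continuous_on_subset)
        then show "continuous_on ?T (\<lambda>s. q (f s))"
          by (rule continuous_on_compose2) auto
      qed (rule continuous_on_id)
      show "fst ` W \<subseteq> ?T"
        using W sub[OF V] by force
      show "(\<lambda>s. (s, q (f s))) ` ?T \<subseteq> W"
        unfolding W using qV sub[OF V] by auto
      show "(fst z, q (f (fst z))) = z" if "z \<in> W" for z
        using that qp unfolding W by auto
      show "fst (s, q (f s)) = s" for s
        by simp
    qed
    then show "\<exists>q. homeomorphism W ?T fst q"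
      by blast
  qed
qed

text \<open>The library lifts functions only along coverings of subsets of normed spaces. The pullback of
  the covering to the interval is such a covering.\<close>

lemma covering_space_lift_interval:
  fixes p :: "'a::real_normed_vector \<Rightarrow> 'b::topological_space" and f :: "real \<Rightarrow> 'b"
  assumes cov: "covering_space C p S" and I: "is_interval I" "t0 \<in> I"
    and f: "continuous_on I f" "f \<in> I \<rightarrow> S" and a: "a \<in> C" "f t0 = p a"
  obtains h where "continuous_on I h" "h \<in> I \<rightarrow> C" "h t0 = a" "\<And>t. t \<in> I \<Longrightarrow> p (h t) = f t"
proof -
  let ?E = "{(t, u). t \<in> I \<and> u \<in> C \<and> f t = p u}"
  have cov': "covering_space ?E fst I"
    using cov f by (rule covering_space_pullback)
  have conv: "convex I"
    using I by (simp add: is_interval_convex)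
  \<comment> \<open>The map to be lifted is now the identity of \<open>I\<close>: a lift is a
    section of the pullback, and its second component is the required lift of
    \<open>f\<close>.\<close>
  obtain g where g: "continuous_on I g" "g \<in> I \<rightarrow> ?E" "g t0 = (t0, a)"
    "\<And>t. t \<in> I \<Longrightarrow> fst (g t) = t"
  proof (rule covering_space_lift_strong[OF cov', of "(t0, a)" t0 I "\<lambda>t. t"])
    show "simply_connected I" "locally path_connected I"
      using conv by (auto intro: convex_imp_simply_connected convex_imp_locally_path_connected)
  qed (use I a in auto)
  show thesis
  proof
    show "continuous_on I (snd \<circ> g)"
      using g(1) by (intro continuous_intros) auto
    have "snd (g t) \<in> C \<and> p (snd (g t)) = f t" if "t \<in> I" for t
    proof -
      have "g t \<in> ?E" "fst (g t) = t"
        using funcset_mem[OF g(2) that] g(4)[OF that] by simp_all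
      then show ?thesis
        by (cases "g t") simp
    qed
    then show "(snd \<circ> g) \<in> I \<rightarrow> C" "\<And>t. t \<in> I \<Longrightarrow> p ((snd \<circ> g) t) = f t"
      by auto
  qed (use g in auto)
qed

section \<open>Differential calculus\<close>

text \<open>The mean value theorem is applied twice: in direction \<open>e\<close> to the difference
  of \<open>F\<close> across the step \<open>r *\<^sub>R h\<close>, then in direction
  \<open>h\<close> to the derivative of \<open>F\<close> along \<open>e\<close>. The left-hand side
  is symmetric in \<open>e\<close> and \<open>h\<close>, which is what makes the lemma
  useful.\<close>

lemma second_difference_mvt:
  fixes F :: "'a::real_normed_vector \<Rightarrow> real"
  assumes r: "0 < r"
    and mem: "\<And>s t. 0 \<le> s \<Longrightarrow> s \<le> r \<Longrightarrow> 0 \<le> t \<Longrightarrow> t \<le> r \<Longrightarrow> x + s *\<^sub>R e + t *\<^sub>R h \<in> U"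
    and F: "\<And>y. y \<in> U \<Longrightarrow> (F has_derivative F' y) (at y)"
    and F': "\<And>y. y \<in> U \<Longrightarrow> ((\<lambda>z. F' z e) has_derivative F'' y) (at y)"
  obtains s t where "0 < s" "s < r" "0 < t" "t < r"
    "F (x + r *\<^sub>R e + r *\<^sub>R h) - F (x + r *\<^sub>R e) - F (x + r *\<^sub>R h) + F x
      = r\<^sup>2 * F'' (x + s *\<^sub>R e + t *\<^sub>R h) h"
proof -
  let ?f = "\<lambda>s. F (x + s *\<^sub>R e + r *\<^sub>R h) - F (x + s *\<^sub>R e)"
  have lin: "F' y (a *\<^sub>R v) = a * F' y v" if "y \<in> U" for y a v
    using linear_cmul[OF has_derivative_linear[OF F[OF that]]] by simp
  have lin2: "F'' y (a *\<^sub>R v) = a * F'' y v" if "y \<in> U" for y a v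
    using linear_cmul[OF has_derivative_linear[OF F'[OF that]]] by simp
  have line: "((\<lambda>s. F (c + s *\<^sub>R e)) has_derivative (\<lambda>u. u * F' (c + s *\<^sub>R e) e)) (at s)"
    if "c + s *\<^sub>R e \<in> U" for c s
  proof -
    have "((\<lambda>s. F (c + s *\<^sub>R e)) has_derivative (\<lambda>u. F' (c + s *\<^sub>R e) (u *\<^sub>R e))) (at s)"
      by (rule has_derivative_compose[where f="\<lambda>s. c + s *\<^sub>R e" and g=F, OF _ F[OF that]])
        (auto intro!: derivative_eq_intros)
    then show ?thesis
      using lin[OF that] by simp
  qed
  have der: "(?f has_derivative (\<lambda>u. u * (F' (x + s *\<^sub>R e + r *\<^sub>R h) e - F' (x + s *\<^sub>R e) e))) (at s)"
    if "0 \<le> s" "s \<le> r" for s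
  proof -
    have "x + r *\<^sub>R h + s *\<^sub>R e \<in> U" "x + s *\<^sub>R e \<in> U"
      using mem[of s r] mem[of s 0] that r by (auto simp: algebra_simps)
    from has_derivative_diff[OF line[OF this(1)] line[OF this(2)]] show ?thesis
      by (simp add: algebra_simps)
  qed
  obtain s where s: "0 < s" "s < r"
    "?f r - ?f 0 = r * (F' (x + s *\<^sub>R e + r *\<^sub>R h) e - F' (x + s *\<^sub>R e) e)"
    using mvt_simple[OF r, of ?f "\<lambda>s u. u * (F' (x + s *\<^sub>R e + r *\<^sub>R h) e - F' (x + s *\<^sub>R e) e)"]
      has_derivative_at_withinI[OF der] by auto
  let ?g = "\<lambda>t. F' (x + s *\<^sub>R e + t *\<^sub>R h) e"
  have der2: "(?g has_derivative (\<lambda>u. u * F'' (x + s *\<^sub>R e + t *\<^sub>R h) h)) (at t)"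
    if "0 \<le> t" "t \<le> r" for t
  proof -
    have U: "x + s *\<^sub>R e + t *\<^sub>R h \<in> U"
      using mem[of s t] that s by auto
    have "(?g has_derivative (\<lambda>u. F'' (x + s *\<^sub>R e + t *\<^sub>R h) (u *\<^sub>R h))) (at t)"
      by (rule has_derivative_compose[where f="\<lambda>t. x + s *\<^sub>R e + t *\<^sub>R h" and g="\<lambda>z. F' z e",
            OF _ F'[OF U]])
        (auto intro!: derivative_eq_intros)
    then show ?thesis
      using lin2[OF U] by simp
  qed
  obtain t where t: "0 < t" "t < r" "?g r - ?g 0 = r * F'' (x + s *\<^sub>R e + t *\<^sub>R h) h"
    using mvt_simple[OF r, of ?g "\<lambda>t u. u * F'' (x + s *\<^sub>R e + t *\<^sub>R h) h"]
      has_derivative_at_withinI[OF der2] by auto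
  show thesis
    using that[OF s(1,2) t(1,2)] s(3) t(3) by (simp add: power2_eq_square algebra_simps)
qed

text \<open>The second difference over a small parallelogram can be evaluated in either order of the
  directions, so values of the two mixed derivatives at points near \<open>x\<close> coincide;
  continuity then forces equality at \<open>x\<close>. The first derivative is assumed
  differentiable only for each fixed direction, the form in which \<open>smooth_on\<close> provides
  it.\<close>

lemma symmetric_second_derivative_real:
  fixes F :: "'a::real_normed_vector \<Rightarrow> real"
  assumes U: "open U" "x \<in> U"
    and F: "\<And>y. y \<in> U \<Longrightarrow> (F has_derivative F' y) (at y)"
    and F': "\<And>v y. y \<in> U \<Longrightarrow> ((\<lambda>z. F' z v) has_derivative F'' v y) (at y)"
    and cont: "\<And>v w. isCont (\<lambda>y. F'' v y w) x"
  shows "F'' e x h = F'' h x e"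
proof (rule ccontr)
  \<comment> \<open>Half of the supposed gap, so that two values strictly within
    \<open>\<epsilon>\<close> of the two sides cannot be equal.\<close>
  define \<epsilon> where "\<epsilon> = \<bar>F'' e x h - F'' h x e\<bar> / 2"
  assume "F'' e x h \<noteq> F'' h x e"
  then have \<epsilon>: "\<epsilon> > 0"
    by (simp add: \<epsilon>_def)
  obtain d1 where d1: "d1 > 0" "\<And>y. dist y x < d1 \<Longrightarrow> dist (F'' e y h) (F'' e x h) < \<epsilon>"
    using cont \<epsilon> unfolding continuous_at_eps_delta by metis
  obtain d2 where d2: "d2 > 0" "\<And>y. dist y x < d2 \<Longrightarrow> dist (F'' h y e) (F'' h x e) < \<epsilon>"
    using cont \<epsilon> unfolding continuous_at_eps_delta by metis
  obtain d3 where d3: "d3 > 0" "ball x d3 \<subseteq> U"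
    using U open_contains_ball by blast
  define d where "d = Min {d1, d2, d3}"
  \<comment> \<open>The summand 1 keeps \<open>N\<close> positive even for \<open>e = h = 0\<close>;
    with \<open>r = d / (2 * N)\<close> the whole parallelogram stays within \<open>d / 2\<close> of
    \<open>x\<close>.\<close>
  define N where "N = norm e + norm h + 1"
  define r where "r = d / (2 * N)"
  have d: "d > 0" "d \<le> d1" "d \<le> d2" "d \<le> d3"
    using d1 d2 d3 by (auto simp: d_def)
  have pos: "N > 0"
    unfolding N_def by (smt (verit) norm_ge_zero)
  have r: "r > 0"
    using d pos by (simp add: r_def)
  have near: "dist (x + s *\<^sub>R e + t *\<^sub>R h) x < d" if "0 \<le> s" "s \<le> r" "0 \<le> t" "t \<le> r" for s t
  proof -
    have "dist (x + s *\<^sub>R e + t *\<^sub>R h) x = norm (s *\<^sub>R e + t *\<^sub>R h)"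
      by (simp add: dist_norm add.assoc)
    also have "\<dots> \<le> s * norm e + t * norm h"
      using that by (intro norm_triangle_le) simp
    also have "\<dots> \<le> r * norm e + r * norm h"
      using that by (intro add_mono mult_right_mono) auto
    also have "\<dots> \<le> r * N"
      using r by (simp add: N_def algebra_simps)
    also have "\<dots> = d / 2"
      unfolding r_def using pos by simp
    finally show ?thesis
      using d by simp
  qed
  have mem: "x + s *\<^sub>R e + t *\<^sub>R h \<in> U" if "0 \<le> s" "s \<le> r" "0 \<le> t" "t \<le> r" for s t
    using near[OF that] d d3(2) by (auto simp: dist_commute subset_iff)
  obtain s t where st: "0 < s" "s < r" "0 < t" "t < r"
    "F (x + r *\<^sub>R e + r *\<^sub>R h) - F (x + r *\<^sub>R e) - F (x + r *\<^sub>R h) + F x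
      = r\<^sup>2 * F'' e (x + s *\<^sub>R e + t *\<^sub>R h) h"
    using second_difference_mvt[where x=x and e=e and h=h and U=U and r=r, OF r mem F F'] by blast
  have mem': "x + t *\<^sub>R h + s *\<^sub>R e \<in> U" if "0 \<le> t" "t \<le> r" "0 \<le> s" "s \<le> r" for s t
    using mem[of s t] that by (simp add: algebra_simps)
  obtain s' t' where st': "0 < s'" "s' < r" "0 < t'" "t' < r"
    "F (x + r *\<^sub>R h + r *\<^sub>R e) - F (x + r *\<^sub>R h) - F (x + r *\<^sub>R e) + F x
      = r\<^sup>2 * F'' h (x + t' *\<^sub>R h + s' *\<^sub>R e) e"
    using second_difference_mvt[where x=x and e=h and h=e and U=U and r=r, OF r mem' F F'] by blast
  have "r\<^sup>2 * F'' e (x + s *\<^sub>R e + t *\<^sub>R h) h = r\<^sup>2 * F'' h (x + s' *\<^sub>R e + t' *\<^sub>R h) e"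
    using st(5) st'(5) by (simp add: algebra_simps)
  then have "F'' e (x + s *\<^sub>R e + t *\<^sub>R h) h = F'' h (x + s' *\<^sub>R e + t' *\<^sub>R h) e"
    using r by simp
  moreover have "dist (F'' e (x + s *\<^sub>R e + t *\<^sub>R h) h) (F'' e x h) < \<epsilon>"
    "dist (F'' h (x + s' *\<^sub>R e + t' *\<^sub>R h) e) (F'' h x e) < \<epsilon>"
    using d1(2) d2(2) near[of s t] near[of s' t'] d st st' by auto
  ultimately show False
    unfolding dist_real_def \<epsilon>_def by argo
qed

lemma symmetric_second_derivative:
  fixes F :: "'a::real_normed_vector \<Rightarrow> 'b::euclidean_space"
  assumes U: "open U" "x \<in> U"
    and F: "\<And>y. y \<in> U \<Longrightarrow> (F has_derivative F' y) (at y)"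
    and F': "\<And>v y. y \<in> U \<Longrightarrow> ((\<lambda>z. F' z v) has_derivative F'' v y) (at y)"
    and cont: "\<And>v w. isCont (\<lambda>y. F'' v y w) x"
  shows "F'' e x h = F'' h x e"
proof (rule euclidean_eqI)
  fix b :: 'b assume "b \<in> Basis"
  show "F'' e x h \<bullet> b = F'' h x e \<bullet> b"
  proof (rule symmetric_second_derivative_real[OF U])
    show "((\<lambda>y. F y \<bullet> b) has_derivative (\<lambda>v. F' y v \<bullet> b)) (at y)" if "y \<in> U" for y
      using F[OF that] by (rule has_derivative_inner_left)
    show "((\<lambda>z. F' z v \<bullet> b) has_derivative (\<lambda>w. F'' v y w \<bullet> b)) (at y)" if "y \<in> U" for v y
      using F'[OF that] by (rule has_derivative_inner_left)
    show "isCont (\<lambda>y. F'' v y w \<bullet> b) x" for v w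
      using cont by (intro continuous_intros)
  qed
qed

text \<open>Writing \<open>\<Delta>\<close> for the increment of \<open>h\<close>, both hypotheses
  describe the increment of \<open>f \<circ> h\<close>, so \<open>L \<Delta>\<close> equals
  \<open>k (s - x)\<close> up to errors small against \<open>s - x\<close> and against
  \<open>\<Delta>\<close>. Applying \<open>L'\<close> isolates \<open>\<Delta>\<close>; continuity
  of \<open>h\<close> makes the expansion of \<open>f\<close> applicable, and a Lipschitz bound for
  \<open>\<Delta>\<close> turns the second error into one of the first kind.\<close>

lemma has_derivative_within_lift:
  fixes f :: "'b::real_normed_vector \<Rightarrow> 'c::real_normed_vector"
    and h :: "'a::real_normed_vector \<Rightarrow> 'b"
  assumes fh: "((\<lambda>s. f (h s)) has_derivative k) (at x within T)"
    and h: "continuous (at x within T) h"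
    and f: "(f has_derivative L) (at (h x))"
    and L': "bounded_linear L'" "\<And>v. L' (L v) = v"
  shows "(h has_derivative (\<lambda>v. L' (k v))) (at x within T)"
  unfolding has_derivative_within_alt
proof (intro conjI allI impI)
  have k: "bounded_linear k" and L: "bounded_linear L"
    using fh f has_derivative_bounded_linear by blast+
  show bl: "bounded_linear (\<lambda>v. L' (k v))"
    by (rule bounded_linear_compose[OF L'(1) k])
  obtain K where K: "K > 0" "\<And>v. norm (L' v) \<le> norm v * K"
    using bounded_linear.pos_bounded[OF L'(1)] by auto
  obtain B where B: "B > 0" "\<And>v. norm (L' (k v)) \<le> norm v * B"
    using bounded_linear.pos_bounded[OF bl] by auto
  fix e :: real assume e: "e > 0"
  \<comment> \<open>The Lipschitz constant of \<open>h\<close> at \<open>x\<close>: the norm of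
    \<open>\<Delta>\<close> is at most \<open>B + K\<close> times that of \<open>s - x\<close> plus
    half of itself, and absorbing the half doubles the constant.\<close>
  define C where "C = 2 * (B + K)"
  have C: "C > 0"
    using B K by (simp add: C_def)
  \<comment> \<open>The first entries make that absorption possible
    (\<open>\<epsilon>1 * K \<le> 1 / 2\<close> and \<open>\<epsilon>2 \<le> 1\<close>); the second
    entries give each of the two error terms one half of \<open>e\<close>.\<close>
  define \<epsilon>1 where "\<epsilon>1 = min (1 / (2 * K)) (e / (2 * K * C))"
  define \<epsilon>2 where "\<epsilon>2 = min 1 (e / (2 * K))"
  have \<epsilon>: "\<epsilon>1 > 0" "\<epsilon>2 > 0" "\<epsilon>1 * K \<le> 1 / 2" "\<epsilon>1 * C * K \<le> e / 2" "\<epsilon>2 \<le> 1" "\<epsilon>2 * K \<le> e / 2"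
    using e K C by (auto simp: \<epsilon>1_def \<epsilon>2_def field_simps min_def)
  obtain d1 where d1: "d1 > 0"
    "\<And>y. norm (y - h x) < d1 \<Longrightarrow> norm (f y - f (h x) - L (y - h x)) \<le> \<epsilon>1 * norm (y - h x)"
    using f \<epsilon>(1) unfolding has_derivative_within_alt by auto
  obtain d2 where d2: "d2 > 0"
    "\<And>s. s \<in> T \<Longrightarrow> norm (s - x) < d2 \<Longrightarrow> norm (f (h s) - f (h x) - k (s - x)) \<le> \<epsilon>2 * norm (s - x)"
    using fh \<epsilon>(2) unfolding has_derivative_within_alt by auto
  obtain d3 where d3: "d3 > 0" "\<And>s. s \<in> T \<Longrightarrow> dist s x < d3 \<Longrightarrow> dist (h s) (h x) < d1"
    using h d1(1) unfolding continuous_within_eps_delta by metis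
  show "\<exists>d>0. \<forall>s\<in>T. norm (s - x) < d \<longrightarrow>
      norm (h s - h x - L' (k (s - x))) \<le> e * norm (s - x)"
  proof (intro exI conjI ballI impI)
    show "min d2 d3 > 0"
      using d2 d3 by simp
    fix s assume s: "s \<in> T" "norm (s - x) < min d2 d3"
    define \<Delta> where "\<Delta> = h s - h x"
    have "dist (h s) (h x) < d1"
      using d3(2)[OF s(1)] s(2) by (simp add: dist_norm)
    then have b1: "norm (f (h s) - f (h x) - L \<Delta>) \<le> \<epsilon>1 * norm \<Delta>"
      using d1(2)[of "h s"] by (simp add: \<Delta>_def dist_norm)
    have b2: "norm (f (h s) - f (h x) - k (s - x)) \<le> \<epsilon>2 * norm (s - x)"
      using d2(2) s by simp
    have "L \<Delta> - k (s - x) = (f (h s) - f (h x) - k (s - x)) - (f (h s) - f (h x) - L \<Delta>)"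
      by simp
    then have "norm (L \<Delta> - k (s - x)) \<le> \<epsilon>2 * norm (s - x) + \<epsilon>1 * norm \<Delta>"
      using b1 b2 norm_triangle_ineq4 by (smt (verit, best))
    moreover have "\<Delta> - L' (k (s - x)) = L' (L \<Delta> - k (s - x))"
      using L' by (simp add: linear_diff bounded_linear.linear)
    ultimately have "norm (\<Delta> - L' (k (s - x))) \<le> (\<epsilon>2 * norm (s - x) + \<epsilon>1 * norm \<Delta>) * K"
      using K by (smt (verit) mult_right_mono)
    then have main: "norm (\<Delta> - L' (k (s - x))) \<le> \<epsilon>2 * K * norm (s - x) + \<epsilon>1 * K * norm \<Delta>"
      by (simp add: algebra_simps)
    have "norm \<Delta> \<le> norm (\<Delta> - L' (k (s - x))) + norm (L' (k (s - x)))"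
      by (metis diff_add_cancel norm_triangle_ineq)
    also have "\<dots> \<le> (\<epsilon>2 * K * norm (s - x) + \<epsilon>1 * K * norm \<Delta>) + norm (s - x) * B"
      using main B(2) by (intro add_mono) auto
    also have "\<dots> \<le> (K * norm (s - x) + 1 / 2 * norm \<Delta>) + norm (s - x) * B"
      using \<epsilon> K by (intro add_mono mult_right_mono order_refl) auto
    finally have "norm \<Delta> \<le> C * norm (s - x)"
      by (simp add: C_def algebra_simps)
    then have "\<epsilon>1 * K * norm \<Delta> \<le> \<epsilon>1 * K * (C * norm (s - x))"
      using \<epsilon> K by (intro mult_left_mono) auto
    also have "\<dots> = \<epsilon>1 * C * K * norm (s - x)"
      by simp
    also have "\<dots> \<le> e / 2 * norm (s - x)"
      using \<epsilon> by (intro mult_right_mono) auto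
    moreover have "\<epsilon>2 * K * norm (s - x) \<le> e / 2 * norm (s - x)"
      using \<epsilon> by (intro mult_right_mono) auto
    ultimately show "norm (h s - h x - L' (k (s - x))) \<le> e * norm (s - x)"
      using main by (simp add: \<Delta>_def)
  qed
qed

text \<open>A product rule for a linear map that depends on a point. Differentiability is known only
  for \<open>L y b\<close> with \<open>b\<close> fixed, so the moving vector is expanded in the
  finite basis, which reduces everything to products of scalar functions with such terms.\<close>

lemma has_derivative_linear_family:
  fixes L :: "'a::real_normed_vector \<Rightarrow> 'b::euclidean_space \<Rightarrow> 'c::real_normed_vector"
    and p :: "'d::real_normed_vector \<Rightarrow> 'a"
  assumes U: "open U" "p x \<in> U" "\<And>y. y \<in> U \<Longrightarrow> linear (L y)"
    and L: "\<And>b. (\<lambda>y. L y b) differentiable (at (p x))"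
    and p: "(p has_derivative p') (at x within T)"
    and v: "(v has_derivative v') (at x within T)" and x: "x \<in> T"
  shows "((\<lambda>z. L (p z) (v z)) has_derivative
      (\<lambda>h. frechet_derivative (\<lambda>y. L y (v x)) (at (p x)) (p' h) + L (p x) (v' h))) (at x within T)"
proof -
  let ?D = "\<lambda>b. frechet_derivative (\<lambda>y. L y b) (at (p x))"
  have expand: "(\<Sum>b\<in>Basis. (w \<bullet> b) *\<^sub>R L y b) = L y w" if "y \<in> U" for y w
  proof -
    have "L y w = L y (\<Sum>b\<in>Basis. (w \<bullet> b) *\<^sub>R b)"
      by (simp add: euclidean_representation)
    also have "\<dots> = (\<Sum>b\<in>Basis. (w \<bullet> b) *\<^sub>R L y b)"
      using U(3)[OF that] by (simp add: linear_sum linear_cmul)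
    finally show ?thesis ..
  qed
  have Lb: "((\<lambda>y. L y b) has_derivative ?D b) (at (p x))" for b
    using L by (simp add: frechet_derivative_works)
  \<comment> \<open>Near \<open>p x\<close> the value \<open>L y w\<close> is linear in
    \<open>w\<close>; therefore so is its derivative in \<open>y\<close>, and the basis expansion
    can be undone after differentiating.\<close>
  have D: "(\<Sum>b\<in>Basis. (w \<bullet> b) *\<^sub>R ?D b u) = ?D w u" for w u
  proof -
    have "((\<lambda>y. \<Sum>b\<in>Basis. (w \<bullet> b) *\<^sub>R L y b) has_derivative
        (\<lambda>u. \<Sum>b\<in>Basis. (w \<bullet> b) *\<^sub>R ?D b u)) (at (p x))"
      by (intro has_derivative_sum has_derivative_scaleR_right Lb)
    then have "((\<lambda>y. L y w) has_derivative (\<lambda>u. \<Sum>b\<in>Basis. (w \<bullet> b) *\<^sub>R ?D b u)) (at (p x))"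
      by (rule has_derivative_transform_within_open[OF _ U(1,2)]) (rule expand)
    from fun_cong[OF frechet_derivative_at[OF this]] show ?thesis .
  qed
  have Lp: "((\<lambda>z. L (p z) b) has_derivative (\<lambda>h. ?D b (p' h))) (at x within T)" for b
    using p Lb by (rule has_derivative_compose)
  have "((\<lambda>z. \<Sum>b\<in>Basis. (v z \<bullet> b) *\<^sub>R L (p z) b) has_derivative
      (\<lambda>h. \<Sum>b\<in>Basis. (v x \<bullet> b) *\<^sub>R ?D b (p' h) + (v' h \<bullet> b) *\<^sub>R L (p x) b)) (at x within T)"
    by (intro has_derivative_sum has_derivative_scaleR has_derivative_inner_left v Lp)
  moreover have "(\<lambda>h. \<Sum>b\<in>Basis. (v x \<bullet> b) *\<^sub>R ?D b (p' h) + (v' h \<bullet> b) *\<^sub>R L (p x) b)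
      = (\<lambda>h. ?D (v x) (p' h) + L (p x) (v' h))"
    by (simp add: sum.distrib D expand U)
  moreover have "\<forall>\<^sub>F z in at x within T. (\<Sum>b\<in>Basis. (v z \<bullet> b) *\<^sub>R L (p z) b) = L (p z) (v z)"
  proof -
    have "(p \<longlongrightarrow> p x) (at x within T)"
      using has_derivative_continuous[OF p] by (simp add: continuous_within)
    then have "\<forall>\<^sub>F z in at x within T. p z \<in> U"
      using U by (simp add: topological_tendstoD)
    then show ?thesis
      by eventually_elim (rule expand)
  qed
  ultimately show ?thesis
    using expand[OF U(2)] x by (auto intro: has_derivative_transform_eventually)
qed

text \<open>The linear case is used twice. With the pair of base point and first argument taken as
  the parameter, the form is linear in its last argument; the differentiability in this parameter
  that the outer use requires is supplied by the inner one.\<close>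

lemma has_derivative_bilinear_family:
  fixes B :: "'a::real_normed_vector \<Rightarrow> 'b::euclidean_space \<Rightarrow> 'c::euclidean_space \<Rightarrow> 'e::real_normed_vector"
    and p :: "'d::real_normed_vector \<Rightarrow> 'a"
  assumes U: "open U" "p x \<in> U" "\<And>y. y \<in> U \<Longrightarrow> bilinear (B y)"
    and B: "\<And>a b. (\<lambda>y. B y a b) differentiable (at (p x))"
    and p: "(p has_derivative p') (at x within T)"
    and a: "(a has_derivative a') (at x within T)"
    and b: "(b has_derivative b') (at x within T)" and x: "x \<in> T"
  shows "((\<lambda>z. B (p z) (a z) (b z)) has_derivative
      (\<lambda>h. frechet_derivative (\<lambda>y. B y (a x) (b x)) (at (p x)) (p' h)
        + B (p x) (a' h) (b x) + B (p x) (a x) (b' h))) (at x within T)"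
proof -
  have lin: "linear (\<lambda>v. B y v w)" "linear (B y w')" if "y \<in> U" for y w w'
    using U(3)[OF that] by (auto simp: bilinear_def)
  let ?L = "\<lambda>q. B (fst q) (snd q)"
  have 1: "((\<lambda>q. B (fst q) (snd q) c) has_derivative
      (\<lambda>h. frechet_derivative (\<lambda>y. B y (a x) c) (at (p x)) (fst h) + B (p x) (snd h) c))
      (at (p x, a x))" for c
    using has_derivative_linear_family[where L="\<lambda>y v. B y v c" and p=fst and v=snd and x="(p x, a x)"
        and T=UNIV and U=U and p'=fst and v'=snd] U B lin
    by (simp add: bounded_linear_fst bounded_linear_snd bounded_linear_imp_has_derivative)
  have "((\<lambda>z. ?L (p z, a z) (b z)) has_derivative
      (\<lambda>h. frechet_derivative (\<lambda>q. ?L q (b x)) (at (p x, a x)) (p' h, a' h) + ?L (p x, a x) (b' h)))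
      (at x within T)"
  proof (rule has_derivative_linear_family[where p="\<lambda>z. (p z, a z)" and U="U \<times> UNIV"])
    show "open (U \<times> (UNIV :: 'b set))"
      using U(1) by (simp add: open_Times)
    show "(\<lambda>q. ?L q c) differentiable at (p x, a x)" for c
      using 1 by (rule differentiableI)
  qed (use U lin b x in \<open>auto intro!: has_derivative_Pair p a\<close>)
  moreover have "frechet_derivative (\<lambda>q. ?L q (b x)) (at (p x, a x)) h
      = frechet_derivative (\<lambda>y. B y (a x) (b x)) (at (p x)) (fst h) + B (p x) (snd h) (b x)" for h
    using fun_cong[OF frechet_derivative_at[OF 1[of "b x"]], of h] by simp
  ultimately show ?thesis
    by simp
qed

text \<open>\<open>T\<close> sends \<open>w\<close> to the vector representing \<open>B w\<close>
  for the Euclidean inner product. Nondegeneracy makes it injective, hence surjective in finite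
  dimension. The unique-existence form is what the definite descriptions behind
  \<open>christoffel\<close> and \<open>grad\<close> call for.\<close>

lemma nondegenerate_form_represents_ex1:
  fixes B :: "'a::euclidean_space \<Rightarrow> 'a \<Rightarrow> real"
  assumes B: "bilinear B" "\<And>w. (\<And>h. B w h = 0) \<Longrightarrow> w = 0" and l: "linear l"
  shows "\<exists>!w. \<forall>h. B w h = l h"
proof -
  define T where "T w = (\<Sum>b\<in>Basis. B w b *\<^sub>R b)" for w
  have linB: "linear (\<lambda>v. B v w)" "linear (B w)" for w
    using B(1) by (auto simp: bilinear_def)
  have T_inner: "T w \<bullet> b = B w b" if "b \<in> Basis" for w b
    using that by (simp add: T_def inner_sum_left inner_Basis if_distrib cong: if_cong)
  have lin: "linear T"
    unfolding T_def
    by (intro linearI)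
      (simp_all add: linear_add[OF linB(1)] linear_cmul[OF linB(1)] scaleR_add_left sum.distrib
        scaleR_sum_right)
  have ext: "B w h = k h" if "linear k" "\<And>b. b \<in> Basis \<Longrightarrow> B w b = k b" for w h and k :: "'a \<Rightarrow> real"
    using linear_eq_stdbasis[OF linB(2) that(1)] that(2) by metis
  have "inj T"
    unfolding linear_injective_0[OF lin]
  proof (intro allI impI)
    fix w assume "T w = 0"
    then have "B w b = 0" if "b \<in> Basis" for b
      using T_inner[OF that, of w] by simp
    then show "w = 0"
      using ext[of "\<lambda>_. 0" w] B(2) by (simp add: linear_zero)
  qed
  then have "surj T"
    using lin by (simp add: linear_injective_imp_surjective)
  then obtain w where w: "T w = (\<Sum>b\<in>Basis. l b *\<^sub>R b)"
    by (metis surjD)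
  have "B w b = l b" if "b \<in> Basis" for b
    unfolding T_inner[OF that, symmetric] w
    using that by (simp add: inner_sum_left inner_Basis if_distrib cong: if_cong)
  then have w: "\<forall>h. B w h = l h"
    using ext l by blast
  show ?thesis
  proof (rule ex1I[of "\<lambda>w. \<forall>h. B w h = l h", OF w])
    fix w' assume "\<forall>h. B w' h = l h"
    then have "B (w' - w) h = 0" for h
      using w by (simp add: linear_diff[OF linB(1)])
    then show "w' = w"
      using B(2)[of "w' - w"] by simp
  qed
qed

section \<open>Functions and curves of class \<open>C\<^sup>k\<close>\<close>

lemma Ck_on_cong:
  assumes "open U" "\<And>x. x \<in> U \<Longrightarrow> f x = g x" "Ck_on k f U"
  shows "Ck_on k g U"
  using assms(2,3)
proof (induction k arbitrary: f g)
  case 0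
  then show ?case
    by (auto cong: continuous_on_cong)
next
  case (Suc k)
  have diff: "f differentiable at x" if "x \<in> U" for x
    using Suc.prems(2) assms(1) that by (simp add: differentiable_on_eq_differentiable_at)
  then have "g differentiable at x" if x: "x \<in> U" for x
  proof -
    obtain D where "(f has_derivative D) (at x)"
      using diff[OF x] by (auto simp: differentiable_def)
    then have "(g has_derivative D) (at x)"
      by (rule has_derivative_transform_within_open[OF _ assms(1) x Suc.prems(1)])
    then show ?thesis
      by (rule differentiableI)
  qed
  then have "g differentiable_on U"
    using assms(1) by (simp add: differentiable_on_eq_differentiable_at)
  moreover have "Ck_on k (\<lambda>x. frechet_derivative g (at x) v) U" for v
  proof (rule Suc.IH)
    show "Ck_on k (\<lambda>x. frechet_derivative f (at x) v) U"
      using Suc.prems(2) by simp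
    show "frechet_derivative f (at x) v = frechet_derivative g (at x) v" if "x \<in> U" for x
      using frechet_derivative_transform_within_open[OF diff[OF that] assms(1) that Suc.prems(1)] by simp
  qed
  ultimately show ?case
    by simp
qed

lemma smooth_on_cong:
  assumes "open U" "\<And>x. x \<in> U \<Longrightarrow> f x = g x" "smooth_on f U"
  shows "smooth_on g U"
  using assms Ck_on_cong unfolding smooth_on_def by blast

lemma smooth_on_imp_differentiable:
  "smooth_on f U \<Longrightarrow> open U \<Longrightarrow> x \<in> U \<Longrightarrow> f differentiable at x"
  by (metis Ck_on.simps(2) differentiable_on_eq_differentiable_at smooth_on_def)

lemma smooth_on_imp_continuous_on: "smooth_on f U \<Longrightarrow> continuous_on U f"
  by (metis Ck_on.simps(1) smooth_on_def)

lemma smooth_on_frechet_derivative: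
  "smooth_on f U \<Longrightarrow> smooth_on (\<lambda>x. frechet_derivative f (at x) v) U"
  by (metis Ck_on.simps(2) smooth_on_def)

lemma smooth_on_cmult:
  fixes f :: "'a::real_normed_vector \<Rightarrow> real"
  assumes U: "open U" and f: "smooth_on f U"
  shows "smooth_on (\<lambda>x. c * f x) U"
proof -
  have "Ck_on k (\<lambda>x. c * f x) U" if "Ck_on k f U" for k
    using that
  proof (induction k arbitrary: f)
    case 0
    then show ?case
      by (auto intro: continuous_intros)
  next
    case (Suc k)
    have diff: "(f has_derivative frechet_derivative f (at x)) (at x)" if "x \<in> U" for x
      using Suc.prems U that by (simp add: differentiable_on_eq_differentiable_at frechet_derivative_works)
    have der: "((\<lambda>x. c * f x) has_derivative (\<lambda>v. c * frechet_derivative f (at x) v)) (at x)"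
      if "x \<in> U" for x
      using diff[OF that] by (rule has_derivative_mult_right)
    then have "(\<lambda>x. c * f x) differentiable_on U"
      using U by (auto simp: differentiable_on_eq_differentiable_at differentiable_def)
    moreover have "Ck_on k (\<lambda>x. frechet_derivative (\<lambda>x. c * f x) (at x) v) U" for v
    proof (rule Ck_on_cong[OF U])
      show "Ck_on k (\<lambda>x. c * frechet_derivative f (at x) v) U"
        using Suc by simp
      show "c * frechet_derivative f (at x) v = frechet_derivative (\<lambda>x. c * f x) (at x) v"
        if "x \<in> U" for x
        using fun_cong[OF frechet_derivative_at[OF der[OF that]], of v] by simp
    qed
    ultimately show ?case
      by simp
  qed
  then show ?thesis
    using f by (simp add: smooth_on_def)
qed

section \<open>Regularity of curves, with derivatives taken within the domain\<close>

lemma Ck_curve_cong: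
  assumes "\<And>t. t \<in> J \<Longrightarrow> f t = g t" "Ck_curve k f J"
  shows "Ck_curve k g J"
  using assms
proof (induction k arbitrary: f g)
  case 0
  then show ?case
    by (auto cong: continuous_on_cong)
next
  case (Suc k)
  have "g differentiable_on J"
    unfolding differentiable_on_def
  proof
    fix t assume t: "t \<in> J"
    then obtain D where "(f has_derivative D) (at t within J)"
      using Suc.prems(2) by (auto simp: differentiable_on_def differentiable_def)
    then have "(g has_derivative D) (at t within J)"
      using has_derivative_transform[OF t, of g f] Suc.prems(1) by metis
    then show "g differentiable at t within J"
      by (rule differentiableI)
  qed
  moreover have "vector_derivative f (at t within J) = vector_derivative g (at t within J)"
    if "t \<in> J" for t
    by (rule vector_derivative_cong_eq) (use Suc.prems that in auto)
  ultimately show ?case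
    using Suc by (metis (no_types, lifting) Ck_curve.simps(2))
qed

lemma Ck_curve_Suc_imp: "Ck_curve (Suc k) f J \<Longrightarrow> Ck_curve k f J"
proof (induction k arbitrary: f)
  case 0
  then show ?case
    by (simp add: differentiable_imp_continuous_on)
qed simp

text \<open>At a point of an open \<open>V\<close>, derivatives within \<open>J\<close> and within
  \<open>J \<inter> V\<close> are the same. This glues the regularity of the lift from pieces that
  each lie over one chart.\<close>

lemma Ck_curve_local:
  assumes "\<And>t. t \<in> J \<Longrightarrow> \<exists>V. open V \<and> t \<in> V \<and> Ck_curve k f (J \<inter> V)"
  shows "Ck_curve k f J"
  using assms
proof (induction k arbitrary: f)
  case 0
  have "continuous (at t within J) f" if t: "t \<in> J" for t
  proof -
    obtain V where "open V" "t \<in> V" "continuous_on (J \<inter> V) f"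
      using 0[OF t] by auto
    moreover from this t have "continuous (at t within J \<inter> V) f"
      by (simp add: continuous_on_eq_continuous_within)
    moreover have "at t within J \<inter> V = at t within J"
      by (rule at_within_nhd[of t V]) (use calculation in auto)
    ultimately show ?thesis
      by simp
  qed
  then show ?case
    by (simp add: continuous_on_eq_continuous_within)
next
  case (Suc k)
  have at_eq: "at t within (J \<inter> V) = at t within J" if "open V" "t \<in> V" for t V
    using that by (intro at_within_nhd[of t V]) auto
  have "f differentiable (at t within J)" if t: "t \<in> J" for t
  proof -
    obtain V where "open V" "t \<in> V" "f differentiable_on (J \<inter> V)"
      using Suc.prems[OF t] by auto
    then show ?thesis
      using t at_eq by (auto simp: differentiable_on_def)
  qed
  moreover have "Ck_curve k (\<lambda>t. vector_derivative f (at t within J)) J"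
  proof (rule Suc.IH)
    fix t assume t: "t \<in> J"
    obtain V where V: "open V" "t \<in> V"
      "Ck_curve k (\<lambda>t. vector_derivative f (at t within J \<inter> V)) (J \<inter> V)"
      using Suc.prems[OF t] by auto
    have "Ck_curve k (\<lambda>t. vector_derivative f (at t within J)) (J \<inter> V)"
      by (rule Ck_curve_cong[OF _ V(3)]) (use at_eq V(1) in auto)
    then show "\<exists>V. open V \<and> t \<in> V \<and> Ck_curve k (\<lambda>t. vector_derivative f (at t within J)) (J \<inter> V)"
      using V by blast
  qed
  ultimately show ?case
    by (simp add: differentiable_on_def)
qed

context
  fixes J :: "real set"
  assumes nontrivial: "\<And>t. t \<in> J \<Longrightarrow> at t within J \<noteq> bot"
begin

text \<open>Any derivative may replace the one chosen by \<open>vector_derivative\<close>. This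
  relies on \<open>nontrivial\<close>: at an isolated point of \<open>J\<close> every vector would
  be a derivative.\<close>

lemma Ck_curve_Suc_iff:
  "Ck_curve (Suc k) f J \<longleftrightarrow>
    (\<exists>f'. (\<forall>t\<in>J. (f has_vector_derivative f' t) (at t within J)) \<and> Ck_curve k f' J)"
proof
  assume "Ck_curve (Suc k) f J"
  then show "\<exists>f'. (\<forall>t\<in>J. (f has_vector_derivative f' t) (at t within J)) \<and> Ck_curve k f' J"
    by (intro exI[of _ "\<lambda>t. vector_derivative f (at t within J)"])
      (auto simp: differentiable_on_def vector_derivative_works)
next
  assume "\<exists>f'. (\<forall>t\<in>J. (f has_vector_derivative f' t) (at t within J)) \<and> Ck_curve k f' J"
  then obtain f' where f': "\<And>t. t \<in> J \<Longrightarrow> (f has_vector_derivative f' t) (at t within J)" "Ck_curve k f' J"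
    by blast
  have "f differentiable_on J"
    using f'(1) unfolding differentiable_on_def differentiable_def has_vector_derivative_def by blast
  moreover have "Ck_curve k (\<lambda>t. vector_derivative f (at t within J)) J"
    by (rule Ck_curve_cong[OF _ f'(2)]) (use nontrivial f'(1) vector_derivative_within in metis)
  ultimately show "Ck_curve (Suc k) f J"
    by simp
qed

lemma Ck_curve_const: "Ck_curve k (\<lambda>_. c) J"
proof (induction k arbitrary: c)
  case (Suc k)
  have "((\<lambda>_. c) has_vector_derivative 0) (at t within J)" for t
    by (rule has_vector_derivative_const)
  then show ?case
    unfolding Ck_curve_Suc_iff using Suc.IH by (intro exI[of _ "\<lambda>_. 0"]) auto
qed simp

lemma Ck_curve_add:
  "Ck_curve k f J \<Longrightarrow> Ck_curve k g J \<Longrightarrow> Ck_curve k (\<lambda>t. f t + g t) J"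
proof (induction k arbitrary: f g)
  case 0
  then show ?case
    by (auto intro: continuous_on_add)
next
  case (Suc k)
  obtain f' g' where f': "\<And>t. t \<in> J \<Longrightarrow> (f has_vector_derivative f' t) (at t within J)" "Ck_curve k f' J"
    and g': "\<And>t. t \<in> J \<Longrightarrow> (g has_vector_derivative g' t) (at t within J)" "Ck_curve k g' J"
    using Suc.prems unfolding Ck_curve_Suc_iff by blast
  show ?case
    unfolding Ck_curve_Suc_iff
    using f' g' Suc.IH by (intro exI[of _ "\<lambda>t. f' t + g' t"]) (auto intro: has_vector_derivative_add)
qed

lemma Ck_curve_sum:
  "finite F \<Longrightarrow> (\<And>i. i \<in> F \<Longrightarrow> Ck_curve k (f i) J) \<Longrightarrow> Ck_curve k (\<lambda>t. \<Sum>i\<in>F. f i t) J"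
  by (induction F rule: finite_induct) (auto intro: Ck_curve_const Ck_curve_add)

text \<open>Stated for a general bounded bilinear \<open>P\<close> so as to serve multiplication,
  scalar multiplication and the inner product alike.\<close>

lemma Ck_curve_bilinear:
  assumes P: "bounded_bilinear P"
  shows "Ck_curve k f J \<Longrightarrow> Ck_curve k g J \<Longrightarrow> Ck_curve k (\<lambda>t. P (f t) (g t)) J"
proof (induction k arbitrary: f g)
  case 0
  then show ?case
    using bounded_bilinear.continuous_on[OF P] by auto
next
  case (Suc k)
  obtain f' g' where f': "\<And>t. t \<in> J \<Longrightarrow> (f has_vector_derivative f' t) (at t within J)" "Ck_curve k f' J"
    and g': "\<And>t. t \<in> J \<Longrightarrow> (g has_vector_derivative g' t) (at t within J)" "Ck_curve k g' J"
    using Suc.prems unfolding Ck_curve_Suc_iff by blast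
  have "Ck_curve k (\<lambda>t. P (f t) (g' t) + P (f' t) (g t)) J"
    by (intro Ck_curve_add Suc.IH f'(2) g'(2) Suc.prems[THEN Ck_curve_Suc_imp])
  then show ?case
    unfolding Ck_curve_Suc_iff
    using f'(1) g'(1)
    by (intro exI[of _ "\<lambda>t. P (f t) (g' t) + P (f' t) (g t)"])
      (auto intro!: bounded_bilinear.has_vector_derivative[OF P])
qed

lemma Ck_curve_compose:
  fixes x :: "real \<Rightarrow> 'a::euclidean_space" and f :: "'a \<Rightarrow> 'b::real_normed_vector"
  assumes U: "open U" "x ` J \<subseteq> U"
  shows "Ck_on k f U \<Longrightarrow> Ck_curve k x J \<Longrightarrow> Ck_curve k (\<lambda>t. f (x t)) J"
proof (induction k arbitrary: f)
  case 0
  then show ?case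
    using U(2) by (auto intro: continuous_on_compose2)
next
  case (Suc k)
  let ?D = "\<lambda>y. frechet_derivative f (at y)"
  obtain x' where x': "\<And>t. t \<in> J \<Longrightarrow> (x has_vector_derivative x' t) (at t within J)" "Ck_curve k x' J"
    using Suc.prems(2) unfolding Ck_curve_Suc_iff by blast
  have D: "(f has_derivative ?D (x t)) (at (x t))" if "t \<in> J" for t
    using Suc.prems(1) U that
    by (auto simp: differentiable_on_eq_differentiable_at simp flip: frechet_derivative_works)
  \<comment> \<open>The chain rule, expanded in the basis because \<open>Ck_on\<close> controls
    derivatives in fixed directions only. Each factor \<open>\<lambda>y. ?D y b\<close> is again of
    class \<open>k\<close> on \<open>U\<close>, so the induction hypothesis applies to it with the
    same curve \<open>x\<close>.\<close>
  have "Ck_curve k (\<lambda>t. \<Sum>b\<in>Basis. (x' t \<bullet> b) *\<^sub>R ?D (x t) b) J"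
  proof (intro Ck_curve_sum Ck_curve_bilinear[OF bounded_bilinear_scaleR]
      Ck_curve_bilinear[OF bounded_bilinear_inner] x'(2) Ck_curve_const Suc.IH)
    show "Ck_on k (\<lambda>y. ?D y b) U" for b
      using Suc.prems(1) by simp
    show "Ck_curve k x J"
      using Suc.prems(2) by (rule Ck_curve_Suc_imp)
  qed simp
  moreover have "((\<lambda>t. f (x t)) has_vector_derivative (\<Sum>b\<in>Basis. (x' t \<bullet> b) *\<^sub>R ?D (x t) b))
      (at t within J)" if t: "t \<in> J" for t
  proof -
    have lin: "linear (?D (x t))"
      using D[OF t] by (rule has_derivative_linear)
    have "(f \<circ> x has_vector_derivative ?D (x t) (x' t)) (at t within J)"
      using vector_derivative_diff_chain_within[OF x'(1)[OF t] has_derivative_at_withinI[OF D[OF t]]] .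
    moreover have "?D (x t) (x' t) = ?D (x t) (\<Sum>b\<in>Basis. (x' t \<bullet> b) *\<^sub>R b)"
      by (simp add: euclidean_representation)
    ultimately show ?thesis
      using lin by (simp add: linear_sum linear_cmul o_def)
  qed
  ultimately have "(\<forall>t\<in>J. ((\<lambda>t. f (x t)) has_vector_derivative
      (\<Sum>b\<in>Basis. (x' t \<bullet> b) *\<^sub>R ?D (x t) b)) (at t within J)) \<and>
      Ck_curve k (\<lambda>t. \<Sum>b\<in>Basis. (x' t \<bullet> b) *\<^sub>R ?D (x t) b) J"
    by blast
  then show ?case
    unfolding Ck_curve_Suc_iff by (rule exI[of _ "\<lambda>t. \<Sum>b\<in>Basis. (x' t \<bullet> b) *\<^sub>R ?D (x t) b"])
qed

end

section \<open>Levi-Civita connection in a chart\<close>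

text \<open>The representation lemma applies once the Koszul expression is linear in
  \<open>h\<close>. Where \<open>h\<close> enters through the form, this follows by differentiating
  the bilinearity of the metric, which must therefore hold on a whole neighbourhood \<open>U\<close>
  of \<open>x\<close>.\<close>

lemma christoffel_koszul:
  assumes U: "open U" "x \<in> U" and bil: "\<And>y. y \<in> U \<Longrightarrow> bilinear (metric_coeff A g c y)"
    and diff: "\<And>a b. (\<lambda>y. metric_coeff A g c y a b) differentiable (at x)"
    and nondeg: "\<And>w. (\<And>h. metric_coeff A g c x w h = 0) \<Longrightarrow> w = 0"
  shows "2 * metric_coeff A g c x (christoffel A g c x e f) h =
       frechet_derivative (\<lambda>y. metric_coeff A g c y f h) (at x) e
     + frechet_derivative (\<lambda>y. metric_coeff A g c y e h) (at x) f
     - frechet_derivative (\<lambda>y. metric_coeff A g c y e f) (at x) h"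
proof -
  let ?m = "metric_coeff A g c"
  let ?D = "\<lambda>a b. frechet_derivative (\<lambda>y. ?m y a b) (at x)"
  have D: "((\<lambda>y. ?m y a b) has_derivative ?D a b) (at x)" for a b
    using diff by (simp add: frechet_derivative_works)
  have add: "?D a (b + b') v = ?D a b v + ?D a b' v" for a b b' v
  proof -
    have "((\<lambda>y. ?m y a (b + b')) has_derivative (\<lambda>v. ?D a b v + ?D a b' v)) (at x)"
      by (rule has_derivative_transform_within_open[OF has_derivative_add[OF D D] U])
        (simp add: bilinear_radd[OF bil])
    from fun_cong[OF frechet_derivative_at[OF this]] show ?thesis
      by simp
  qed
  have cmul: "?D a (r *\<^sub>R b) v = r * ?D a b v" for a b r v
  proof -
    have "((\<lambda>y. ?m y a (r *\<^sub>R b)) has_derivative (\<lambda>v. r * ?D a b v)) (at x)"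
      by (rule has_derivative_transform_within_open[OF has_derivative_mult_right[OF D] U])
        (simp add: bilinear_rmul[OF bil])
    from fun_cong[OF frechet_derivative_at[OF this]] show ?thesis
      by simp
  qed
  have lin: "linear (?D a b)" for a b
    using D by (rule has_derivative_linear)
  define l where "l h = (?D f h e + ?D e h f - ?D e f h) / 2" for h
  have "linear l"
    unfolding l_def
    by (intro linearI) (simp_all add: add cmul linear_add[OF lin] linear_cmul[OF lin] field_simps)
  then have "\<exists>!w. \<forall>h. ?m x w h = l h"
    using bil[OF U(2)] nondeg by (intro nondegenerate_form_represents_ex1) auto
  then have "\<exists>!w. \<forall>h. 2 * ?m x w h = ?D f h e + ?D e h f - ?D e f h"
    by (simp add: l_def field_simps)
  from theI'[OF this] show ?thesis
    unfolding christoffel_def by blast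
qed

section \<open>The Poincare disk\<close>

text \<open>The base point does not appear: the disk has a single chart, so a tangent vector is the
  same function at every point.\<close>

definition disk_vec :: "complex \<Rightarrow> complex tvec" where
  "disk_vec e = (\<lambda>d. if d = disk_chart then e else 0)"

definition poincare_factor :: "complex \<Rightarrow> real" where
  "poincare_factor u = 4 / (1 - (cmod u)\<^sup>2)\<^sup>2"

lemma poincare_factor_pos: "u \<in> disk \<Longrightarrow> poincare_factor u > 0"
  using abs_square_less_1[of "cmod u"] by (simp add: poincare_factor_def)

lemma poincare_factor_differentiable: "u \<in> disk \<Longrightarrow> poincare_factor differentiable at u"
proof -
  assume "u \<in> disk"
  then have nz: "1 - u \<bullet> u \<noteq> 0"
    using abs_square_less_1[of "cmod u"] by (simp add: dot_square_norm)
  \<comment> \<open>The squared norm is written as an inner product because the norm itself is not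
    differentiable at 0.\<close>
  have "(\<lambda>u. 4 / (1 - u \<bullet> u)\<^sup>2) differentiable at u"
    using nz by (intro derivative_intros) auto
  then show ?thesis
    by (simp add: poincare_factor_def[abs_def] dot_square_norm)
qed

lemma disk_vec_apply [simp]: "disk_vec e disk_chart = e"
  by (simp add: disk_vec_def)

lemma charts_at_disk [simp]: "u \<in> disk \<Longrightarrow> charts_at disk_atlas u = {disk_chart}"
  by (auto simp: charts_at_def disk_atlas_def disk_chart_def)

lemma some_chart_disk [simp]: "u \<in> disk \<Longrightarrow> some_chart disk_atlas u = disk_chart"
  by (simp add: some_chart_def)

lemma disk_chart_simps [simp]: "fst disk_chart = disk" "snd disk_chart u = u"
  by (simp_all add: disk_chart_def)

lemma chart_inv_disk [simp]: "u \<in> disk \<Longrightarrow> inv_into disk (snd disk_chart) u = u"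
  using inv_into_f_f[of "\<lambda>u. u" disk u] by (simp add: disk_chart_def)

text \<open>\<open>inv_into\<close> has no specified values off the disk; the derivative does not
  see them, since the disk is open.\<close>

lemma frechet_derivative_chart_inv_disk:
  assumes "u \<in> disk" "F differentiable at u"
  shows "frechet_derivative (\<lambda>x. F (inv_into disk (snd disk_chart) x)) (at u) = frechet_derivative F (at u)"
  using frechet_derivative_transform_within_open[OF assms(2) open_ball assms(1),
      of "\<lambda>x. F (inv_into disk (snd disk_chart) x)"]
  by simp

lemma frechet_derivative_transition_disk:
  "u \<in> disk \<Longrightarrow> frechet_derivative (transition disk_chart disk_chart) (at u) = (\<lambda>e. e)"
  using frechet_derivative_chart_inv_disk[of u "\<lambda>u. u"] by (simp add: transition_def[abs_def])

lemma tspace_disk: "u \<in> disk \<Longrightarrow> tspace disk_atlas u = range disk_vec"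
  by (force simp: tspace_def frechet_derivative_transition_disk disk_vec_def fun_eq_iff image_iff)

lemma coord_vec_disk: "u \<in> disk \<Longrightarrow> coord_vec disk_atlas disk_chart u e = disk_vec e"
  by (simp add: coord_vec_def disk_vec_def frechet_derivative_transition_disk fun_eq_iff)

lemma poincare_metric_disk_vec:
  "poincare_metric u (disk_vec a) (disk_vec b) = poincare_factor u * (a \<bullet> b)"
  by (simp add: poincare_metric_def poincare_factor_def)

lemma metric_coeff_disk:
  "u \<in> disk \<Longrightarrow> metric_coeff disk_atlas poincare_metric disk_chart u a b = poincare_factor u * (a \<bullet> b)"
  by (simp add: metric_coeff_def coord_vec_disk poincare_metric_disk_vec)

lemma metric_coeff_disk_differentiable:
  assumes "u \<in> disk"
  shows "(\<lambda>y. metric_coeff disk_atlas poincare_metric disk_chart y a b) differentiable at u"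
proof -
  have "(\<lambda>y. poincare_factor y * (a \<bullet> b)) differentiable at u"
    using poincare_factor_differentiable[OF assms] by (intro derivative_intros)
  then obtain D where "((\<lambda>y. poincare_factor y * (a \<bullet> b)) has_derivative D) (at u)"
    by (auto simp: differentiable_def)
  then have "((\<lambda>y. metric_coeff disk_atlas poincare_metric disk_chart y a b) has_derivative D) (at u)"
    by (rule has_derivative_transform_within_open[OF _ open_ball assms]) (simp add: metric_coeff_disk)
  then show ?thesis
    by (rule differentiableI)
qed

lemma fun_diff_disk:
  "u \<in> disk \<Longrightarrow> F differentiable at u \<Longrightarrow>
    fun_diff disk_atlas F u (disk_vec e) = frechet_derivative F (at u) e"
  by (simp add: fun_diff_def frechet_derivative_chart_inv_disk)

lemma christoffel_disk_koszul:
  assumes "u \<in> disk"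
  shows "2 * poincare_factor u * (christoffel disk_atlas poincare_metric disk_chart u e f \<bullet> h) =
       frechet_derivative (\<lambda>y. metric_coeff disk_atlas poincare_metric disk_chart y f h) (at u) e
     + frechet_derivative (\<lambda>y. metric_coeff disk_atlas poincare_metric disk_chart y e h) (at u) f
     - frechet_derivative (\<lambda>y. metric_coeff disk_atlas poincare_metric disk_chart y e f) (at u) h"
proof -
  let ?m = "metric_coeff disk_atlas poincare_metric disk_chart"
  have "bilinear (?m y)" if "y \<in> disk" for y
    unfolding bilinear_def metric_coeff_disk[OF that]
    by (auto intro!: linearI simp: algebra_simps)
  moreover have "w = 0" if "\<And>h. ?m u w h = 0" for w
    using that[of w] poincare_factor_pos[OF assms] by (simp add: metric_coeff_disk[OF assms])
  ultimately show ?thesis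
    using christoffel_koszul[where U=disk and x=u and A=disk_atlas and g=poincare_metric and c=disk_chart]
      metric_coeff_disk_differentiable[OF assms] assms
    by (simp add: metric_coeff_disk mult.assoc)
qed

section \<open>Homotheties from the Poincare disk\<close>

text \<open>To be used with \<open>g\<close> as the rescaled metric and \<open>\<kappa>\<close> as
  \<open>3 * \<alpha>\<close>.\<close>

locale poincare_homothety =
  fixes S :: "'a::topological_space set" and A :: "'a chart set" and g :: "'a metric"
    and \<pi> :: "complex \<Rightarrow> 'a" and \<kappa> :: real
  assumes atlas: "oriented_atlas S A"
    and smooth: "smooth_map disk disk_atlas S A \<pi>"
    and surj: "\<pi> ` disk = S"
    and smooth_coeff: "\<And>c a b. c \<in> A \<Longrightarrow> smooth_on (\<lambda>x. metric_coeff A g c x a b) (chart_image c)"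
    and \<kappa>: "\<kappa> > 0"
    and homothety: "\<And>u v w. u \<in> disk \<Longrightarrow> v \<in> tspace disk_atlas u \<Longrightarrow> w \<in> tspace disk_atlas u \<Longrightarrow>
      g (\<pi> u) (map_diff disk_atlas A \<pi> u v) (map_diff disk_atlas A \<pi> u w) = \<kappa> * poincare_metric u v w"
begin

definition loc :: "'a chart \<Rightarrow> complex \<Rightarrow> complex" where
  "loc d u = snd d (\<pi> u)"

definition dloc :: "'a chart \<Rightarrow> complex \<Rightarrow> complex \<Rightarrow> complex" where
  "dloc d u = frechet_derivative (loc d) (at u)"

definition chart_dom :: "'a chart \<Rightarrow> complex set" where
  "chart_dom d = disk \<inter> \<pi> -` fst d"

definition push :: "complex \<Rightarrow> complex \<Rightarrow> 'a tvec" where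
  "push u e = map_diff disk_atlas A \<pi> u (disk_vec e)"

section \<open>Charts of \<open>S\<close> and the local expressions of \<open>\<pi>\<close>\<close>

lemma chart:
  assumes "d \<in> A"
  shows "openin (top_of_set S) (fst d)" "open (chart_image d)"
    "homeomorphism (fst d) (chart_image d) (snd d) (chart_inv d)"
  using atlas assms by (auto simp: oriented_atlas_def)

lemma chart_inv_apply: "d \<in> A \<Longrightarrow> p \<in> fst d \<Longrightarrow> chart_inv d (snd d p) = p"
  using chart(3) by (auto simp: homeomorphism_def)

lemma continuous_\<pi>: "continuous_on disk \<pi>"
  using smooth by (simp add: smooth_map_def)

lemma exists_chart: "u \<in> disk \<Longrightarrow> \<exists>d\<in>A. u \<in> chart_dom d"
proof -
  assume u: "u \<in> disk"
  then have "\<pi> u \<in> \<Union> (fst ` A)"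
    using surj atlas by (auto simp: oriented_atlas_def)
  then show ?thesis
    using u by (auto simp: chart_dom_def)
qed

lemma in_chart_dom: "u \<in> disk \<Longrightarrow> d \<in> charts_at A (\<pi> u) \<longleftrightarrow> d \<in> A \<and> u \<in> chart_dom d"
  by (auto simp: charts_at_def chart_dom_def)

lemma chart_dom_disk: "u \<in> chart_dom d \<Longrightarrow> u \<in> disk"
  by (simp add: chart_dom_def)

lemma open_chart_dom: "d \<in> A \<Longrightarrow> open (chart_dom d)"
proof -
  assume "d \<in> A"
  then have "openin (top_of_set disk) (chart_dom d)"
    unfolding chart_dom_def using continuous_openin_preimage[OF continuous_\<pi>, of S] chart(1) surj by blast
  then show ?thesis
    using openin_open_trans open_ball by blast
qed

lemma smooth_loc:
  assumes d: "d \<in> A"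
  shows "smooth_on (loc d) (chart_dom d)"
proof (rule smooth_on_cong[OF open_chart_dom[OF d]])
  have "snd disk_chart ` (fst disk_chart \<inter> \<pi> -` fst d) = chart_dom d"
    by (auto simp: chart_dom_def disk_chart_def)
  then show "smooth_on (\<lambda>x. snd d (\<pi> (chart_inv disk_chart x))) (chart_dom d)"
    using smooth d unfolding smooth_map_def disk_atlas_def by (metis insertI1)
qed (simp add: loc_def chart_dom_def)

lemma loc_differentiable: "d \<in> A \<Longrightarrow> u \<in> chart_dom d \<Longrightarrow> loc d differentiable at u"
  using smooth_on_imp_differentiable[OF smooth_loc open_chart_dom] .

lemma loc_has_derivative: "d \<in> A \<Longrightarrow> u \<in> chart_dom d \<Longrightarrow> (loc d has_derivative dloc d u) (at u)"
  using loc_differentiable by (simp add: dloc_def frechet_derivative_works)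

lemma linear_dloc: "d \<in> A \<Longrightarrow> u \<in> chart_dom d \<Longrightarrow> linear (dloc d u)"
  using loc_has_derivative by (rule has_derivative_linear)

lemma smooth_dloc: "d \<in> A \<Longrightarrow> smooth_on (\<lambda>u. dloc d u e) (chart_dom d)"
  unfolding dloc_def by (intro smooth_on_frechet_derivative smooth_loc)

lemma loc_in_image: "u \<in> chart_dom d \<Longrightarrow> loc d u \<in> chart_image d"
  by (auto simp: loc_def chart_dom_def)

lemma chart_image_eq_loc:
  assumes d: "d \<in> A" and x: "x \<in> chart_image d"
  obtains u where "u \<in> chart_dom d" "x = loc d u"
proof -
  obtain p where p: "p \<in> fst d" "x = snd d p"
    using x by auto
  then have "p \<in> S"
    using chart(1)[OF d] openin_imp_subset by blast
  then obtain u where "u \<in> disk" "p = \<pi> u"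
    using surj by blast
  then show thesis
    using p by (intro that[of u]) (auto simp: chart_dom_def loc_def)
qed

lemma transition_has_derivative:
  assumes c: "c \<in> A" and d: "d \<in> A" and p: "p \<in> fst c" "p \<in> fst d"
  shows "(transition c d has_derivative frechet_derivative (transition c d) (at (snd c p))) (at (snd c p))"
proof -
  have "openin (top_of_set S) (fst c \<inter> fst d)"
    using chart(1)[OF c] chart(1)[OF d] by (rule openin_Int)
  then have "openin (top_of_set (fst c)) (fst c \<inter> fst d)"
    by (rule openin_subset_trans) (use openin_imp_subset[OF chart(1)[OF c]] in auto)
  then have "openin (top_of_set (chart_image c)) (snd c ` (fst c \<inter> fst d))"
    using chart(3)[OF c] homeomorphism_imp_open_map by blast
  then have "open (snd c ` (fst c \<inter> fst d))"
    using chart(2)[OF c] openin_open_trans by blast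
  moreover have "smooth_on (transition c d) (snd c ` (fst c \<inter> fst d))"
    using atlas c d by (simp add: oriented_atlas_def)
  ultimately have "transition c d differentiable at (snd c p)"
    using p by (intro smooth_on_imp_differentiable) auto
  then show ?thesis
    by (simp add: frechet_derivative_works)
qed

text \<open>The chain rule for \<open>loc d\<close>, which near \<open>u\<close> is
  \<open>loc c\<close> followed by the transition map. It says that the vectors
  \<open>dloc d u e\<close>, for varying \<open>d\<close>, are the components of one tangent
  vector.\<close>

lemma dloc_transition:
  assumes "c \<in> A" "d \<in> A" "u \<in> chart_dom c" "u \<in> chart_dom d"
  shows "dloc d u e = frechet_derivative (transition c d) (at (loc c u)) (dloc c u e)"
proof -
  have "(transition c d has_derivative frechet_derivative (transition c d) (at (loc c u))) (at (loc c u))"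
    using transition_has_derivative[of c d "\<pi> u"] assms by (simp add: loc_def chart_dom_def)
  then have "((\<lambda>u. transition c d (loc c u)) has_derivative
      (\<lambda>e. frechet_derivative (transition c d) (at (loc c u)) (dloc c u e))) (at u)"
    by (rule has_derivative_compose[OF loc_has_derivative[OF assms(1,3)]])
  then have "(loc d has_derivative
      (\<lambda>e. frechet_derivative (transition c d) (at (loc c u)) (dloc c u e))) (at u)"
  proof (rule has_derivative_transform_within_open[of _ _ _ _ "chart_dom c"])
    show "transition c d (loc c y) = loc d y" if "y \<in> chart_dom c" for y
      using that chart_inv_apply[OF assms(1)] by (simp add: transition_def loc_def chart_dom_def)
  qed (use assms open_chart_dom in auto)
  from fun_cong[OF frechet_derivative_at[OF this]] show ?thesis
    by (simp add: dloc_def)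
qed

section \<open>The differential of \<open>\<pi>\<close> as an isomorphism of tangent planes\<close>

lemma push_eq:
  assumes u: "u \<in> disk"
  shows "push u e = (\<lambda>d. if d \<in> charts_at A (\<pi> u) then dloc d u e else 0)"
proof
  fix d
  show "push u e d = (if d \<in> charts_at A (\<pi> u) then dloc d u e else 0)"
  proof (cases "d \<in> charts_at A (\<pi> u)")
    case True
    then have "loc d differentiable at u"
      using in_chart_dom[OF u] loc_differentiable by blast
    from frechet_derivative_chart_inv_disk[OF u this] True u show ?thesis
      by (simp add: push_def map_diff_def dloc_def loc_def)
  qed (simp add: push_def map_diff_def)
qed

lemma push_apply: "d \<in> A \<Longrightarrow> u \<in> chart_dom d \<Longrightarrow> push u e d = dloc d u e"
  using chart_dom_disk[of u d] by (simp add: push_eq in_chart_dom)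

lemma push_in_tspace: "u \<in> disk \<Longrightarrow> push u e \<in> tspace A (\<pi> u)"
  using dloc_transition[of _ _ u e] by (auto simp: tspace_def push_eq in_chart_dom simp flip: loc_def)

lemma g_push:
  "u \<in> disk \<Longrightarrow> g (\<pi> u) (push u a) (push u b) = \<kappa> * poincare_factor u * (a \<bullet> b)"
  using homothety[of u "disk_vec a" "disk_vec b"]
  by (simp add: push_def tspace_disk poincare_metric_disk_vec)

text \<open>If \<open>\<pi>\<close> killed \<open>e\<close>, then \<open>e\<close> and \<open>0\<close> would have the same image, hence the same length.\<close>

lemma dloc_eq_0:
  assumes d: "d \<in> A" "u \<in> chart_dom d" and e: "dloc d u e = 0"
  shows "e = 0"
proof -
  have "dloc c u e = dloc c u 0" if "c \<in> A" "u \<in> chart_dom c" for c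
    using dloc_transition[OF d(1) that(1) d(2) that(2)] e linear_0[OF linear_dloc[OF d]] by simp
  then have "push u e = push u 0"
    using chart_dom_disk[OF d(2)] by (auto simp: push_eq in_chart_dom)
  then show ?thesis
    using g_push[OF chart_dom_disk[OF d(2)], of e e] g_push[OF chart_dom_disk[OF d(2)], of 0 0]
      \<kappa> poincare_factor_pos[OF chart_dom_disk[OF d(2)]] by simp
qed

lemma inj_dloc: "d \<in> A \<Longrightarrow> u \<in> chart_dom d \<Longrightarrow> inj (dloc d u)"
  using dloc_eq_0 linear_dloc linear_injective_0 by blast

text \<open>An injective linear endomorphism of the plane is onto. Hence every coordinate vector can
  be written as \<open>dloc d u e\<close>, the form on which the metric is computable.\<close>

lemma dloc_surj:
  assumes "d \<in> A" "u \<in> chart_dom d"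
  obtains e where "x = dloc d u e"
  using linear_injective_imp_surjective[OF linear_dloc[OF assms] inj_dloc[OF assms]] surjD by metis

lemma push_inject: "u \<in> disk \<Longrightarrow> push u a = push u b \<longleftrightarrow> a = b"
proof -
  assume "u \<in> disk"
  then obtain d where d: "d \<in> A" "u \<in> chart_dom d"
    using exists_chart by blast
  then show ?thesis
    using push_apply[OF d] inj_dloc[OF d] by (metis injD)
qed

lemma coord_vec_push:
  assumes "d \<in> A" "u \<in> chart_dom d"
  shows "coord_vec A d (\<pi> u) (dloc d u e) = push u e"
  using dloc_transition[OF assms(1) _ assms(2)] chart_dom_disk[OF assms(2)]
  by (auto simp: coord_vec_def push_eq in_chart_dom simp flip: loc_def)

text \<open>A tangent vector is determined by its component in a single chart, and in that chart
  \<open>dloc\<close> reaches every component.\<close>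

lemma tspace_eq_push:
  assumes u: "u \<in> disk" and z: "z \<in> tspace A (\<pi> u)"
  obtains e where "z = push u e"
proof -
  obtain d where d: "d \<in> A" "u \<in> chart_dom d"
    using exists_chart[OF u] by blast
  obtain e where e: "z d = dloc d u e"
    using dloc_surj[OF d] .
  have "z = coord_vec A d (\<pi> u) (z d)"
  proof
    fix c
    have "d \<in> charts_at A (\<pi> u)"
      using d in_chart_dom[OF u] by blast
    then have "c \<in> charts_at A (\<pi> u) \<Longrightarrow> z c = frechet_derivative (transition d c) (at (snd d (\<pi> u))) (z d)"
      "c \<notin> charts_at A (\<pi> u) \<Longrightarrow> z c = 0"
      using z unfolding tspace_def by blast+
    then show "z c = coord_vec A d (\<pi> u) (z d) c"
      unfolding coord_vec_def by presburger
  qed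
  then show thesis
    using that e coord_vec_push[OF d] by metis
qed

section \<open>Coefficients of \<open>g\<close> along \<open>\<pi>\<close>, read off from the
  Poincare metric\<close>

lemma coeff_dloc:
  assumes "d \<in> A" "u \<in> chart_dom d"
  shows "metric_coeff A g d (loc d u) (dloc d u a) (dloc d u b) = \<kappa> * poincare_factor u * (a \<bullet> b)"
  using g_push[OF chart_dom_disk[OF assms(2)]] chart_inv_apply[OF assms(1), of "\<pi> u"] assms
  by (simp add: metric_coeff_def loc_def chart_dom_def coord_vec_push)

lemma bilinear_coeff:
  assumes d: "d \<in> A" and x: "x \<in> chart_image d"
  shows "bilinear (metric_coeff A g d x)"
proof -
  obtain u where u: "u \<in> chart_dom d" and xu: "x = loc d u"
    using chart_image_eq_loc[OF d x] .
  note lin = linear_add[OF linear_dloc[OF d u], symmetric] linear_cmul[OF linear_dloc[OF d u], symmetric]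
  have *: "\<exists>a. y = dloc d u a" for y
    using dloc_surj[OF d u] by metis
  have "linear (metric_coeff A g d x y)" "linear (\<lambda>y. metric_coeff A g d x y z)" for y z
  proof -
    obtain a c where a: "y = dloc d u a" "z = dloc d u c"
      using * by metis
    show "linear (metric_coeff A g d x y)"
    proof (rule linearI)
      fix b1 b2 r
      obtain a1 a2 where "b1 = dloc d u a1" "b2 = dloc d u a2"
        using * by metis
      then show "metric_coeff A g d x y (b1 + b2) = metric_coeff A g d x y b1 + metric_coeff A g d x y b2"
        "metric_coeff A g d x y (r *\<^sub>R b1) = r *\<^sub>R metric_coeff A g d x y b1"
        by (simp_all add: a xu coeff_dloc[OF d u] lin algebra_simps)
    qed
    show "linear (\<lambda>y. metric_coeff A g d x y z)"
    proof (rule linearI)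
      fix b1 b2 r
      obtain a1 a2 where "b1 = dloc d u a1" "b2 = dloc d u a2"
        using * by metis
      then show "metric_coeff A g d x (b1 + b2) z = metric_coeff A g d x b1 z + metric_coeff A g d x b2 z"
        "metric_coeff A g d x (r *\<^sub>R b1) z = r *\<^sub>R metric_coeff A g d x b1 z"
        by (simp_all add: a xu coeff_dloc[OF d u] lin algebra_simps)
    qed
  qed
  then show ?thesis
    by (simp add: bilinear_def)
qed

lemma coeff_commute:
  assumes d: "d \<in> A" "u \<in> chart_dom d"
  shows "metric_coeff A g d (loc d u) x y = metric_coeff A g d (loc d u) y x"
proof -
  obtain a b where "x = dloc d u a" "y = dloc d u b"
    using dloc_surj[OF d] by metis
  then show ?thesis
    by (simp add: coeff_dloc[OF d] inner_commute)
qed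

lemma coeff_nondegenerate:
  assumes d: "d \<in> A" "u \<in> chart_dom d" and w: "\<And>h. metric_coeff A g d (loc d u) w (dloc d u h) = 0"
  shows "w = 0"
proof -
  obtain a where a: "w = dloc d u a"
    using dloc_surj[OF d] .
  then have "a = 0"
    using w[of a] \<kappa> poincare_factor_pos[OF chart_dom_disk[OF d(2)]] by (simp add: coeff_dloc[OF d])
  then show ?thesis
    using a linear_0[OF linear_dloc[OF d]] by simp
qed

lemma coeff_differentiable:
  "d \<in> A \<Longrightarrow> x \<in> chart_image d \<Longrightarrow> (\<lambda>y. metric_coeff A g d y a b) differentiable at x"
  using smooth_on_imp_differentiable[OF smooth_coeff chart(2)] .

section \<open>Second derivatives of \<open>\<pi>\<close> and the transformation law of the
  Christoffel symbols\<close>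

lemma dloc_has_derivative:
  "d \<in> A \<Longrightarrow> u \<in> chart_dom d \<Longrightarrow>
    ((\<lambda>y. dloc d y e) has_derivative frechet_derivative (\<lambda>y. dloc d y e) (at u)) (at u)"
  using smooth_on_imp_differentiable[OF smooth_dloc open_chart_dom] by (simp add: frechet_derivative_works)

lemma second_derivative_loc_commute:
  assumes d: "d \<in> A" "u \<in> chart_dom d"
  shows "frechet_derivative (\<lambda>y. dloc d y e) (at u) h = frechet_derivative (\<lambda>y. dloc d y h) (at u) e"
proof (rule symmetric_second_derivative[where F="loc d" and F'="dloc d"
      and F''="\<lambda>v y. frechet_derivative (\<lambda>z. dloc d z v) (at y)", OF open_chart_dom[OF d(1)] d(2)])
  show "(loc d has_derivative dloc d y) (at y)" if "y \<in> chart_dom d" for y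
    using loc_has_derivative[OF d(1) that] .
  show "((\<lambda>z. dloc d z v) has_derivative frechet_derivative (\<lambda>y. dloc d y v) (at y)) (at y)"
    if "y \<in> chart_dom d" for v y
    using dloc_has_derivative[OF d(1) that] .
  show "isCont (\<lambda>y. frechet_derivative (\<lambda>y. dloc d y v) (at y) w) u" for v w
    using smooth_on_imp_continuous_on[OF smooth_on_frechet_derivative[OF smooth_dloc[OF d(1)]]]
      open_chart_dom[OF d(1)] d(2) continuous_on_eq_continuous_at by blast
qed

text \<open>This is \<open>coeff_dloc\<close> differentiated in \<open>u\<close>: the coefficient
  varies with its point, and both of its arguments vary through \<open>dloc\<close>.\<close>

lemma coeff_derivative_loc:
  assumes d: "d \<in> A" "u \<in> chart_dom d"
  shows "\<kappa> * frechet_derivative (\<lambda>y. metric_coeff disk_atlas poincare_metric disk_chart y a b) (at u) h =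
      frechet_derivative (\<lambda>y. metric_coeff A g d y (dloc d u a) (dloc d u b)) (at (loc d u)) (dloc d u h)
    + metric_coeff A g d (loc d u) (frechet_derivative (\<lambda>y. dloc d y a) (at u) h) (dloc d u b)
    + metric_coeff A g d (loc d u) (dloc d u a) (frechet_derivative (\<lambda>y. dloc d y b) (at u) h)"
    (is "_ = ?R h")
proof -
  let ?m = "metric_coeff disk_atlas poincare_metric disk_chart"
  have u: "u \<in> disk"
    using d(2) by (rule chart_dom_disk)
  have "((\<lambda>y. metric_coeff A g d (loc d y) (dloc d y a) (dloc d y b)) has_derivative ?R) (at u)"
    by (rule has_derivative_bilinear_family[where U="chart_image d"])
      (use d in \<open>auto intro: chart loc_in_image bilinear_coeff coeff_differentiable
        loc_has_derivative dloc_has_derivative\<close>)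
  then have R: "((\<lambda>y. \<kappa> * ?m y a b) has_derivative ?R) (at u)"
    by (rule has_derivative_transform_within_open[OF _ open_chart_dom[OF d(1)] d(2)])
      (simp only: coeff_dloc[OF d(1)] metric_coeff_disk[OF chart_dom_disk] mult.assoc)
  have "((\<lambda>y. ?m y a b) has_derivative frechet_derivative (\<lambda>y. ?m y a b) (at u)) (at u)"
    using metric_coeff_disk_differentiable[OF u] by (simp add: frechet_derivative_works)
  from has_derivative_mult_right[OF this, of \<kappa>]
  have "(\<lambda>h. \<kappa> * frechet_derivative (\<lambda>y. ?m y a b) (at u) h) = ?R"
    using R has_derivative_unique by blast
  then show ?thesis
    by (rule fun_cong)
qed

text \<open>The classical transformation law, whose last term is the second derivative of
  \<open>\<pi>\<close> in the chart. The scale \<open>\<kappa>\<close> disappears because the Koszul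
  formula is linear in the metric on both of its sides.\<close>

lemma christoffel_loc:
  assumes d: "d \<in> A" "u \<in> chart_dom d"
  shows "dloc d u (christoffel disk_atlas poincare_metric disk_chart u e f) =
    christoffel A g d (loc d u) (dloc d u e) (dloc d u f) + frechet_derivative (\<lambda>y. dloc d y f) (at u) e"
    (is "dloc d u ?\<Gamma> = ?\<Gamma>' + ?D f e")
proof -
  let ?m = "metric_coeff A g d (loc d u)" and ?L = "dloc d u"
  let ?D = "\<lambda>a. frechet_derivative (\<lambda>y. dloc d y a) (at u)"
  have u: "u \<in> disk" and x: "loc d u \<in> chart_image d"
    using d(2) by (rule chart_dom_disk, rule loc_in_image)
  have bil: "bilinear ?m"
    using d(1) x by (rule bilinear_coeff)
  \<comment> \<open>Three instances of \<open>coeff_derivative_loc\<close> contribute six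
    second-derivative terms. By symmetry, the four that differentiate in or along \<open>h\<close>
    cancel in pairs, and the other two coincide, which gives the factor 2.\<close>
  have *: "2 * ?m (?L ?\<Gamma>) (?L h) = 2 * ?m ?\<Gamma>' (?L h) + 2 * ?m (?D f e) (?L h)" for h
  proof -
    have "2 * ?m (?L ?\<Gamma>) (?L h) = \<kappa> * (2 * poincare_factor u * (?\<Gamma> \<bullet> h))"
      by (simp add: coeff_dloc[OF d])
    also note christoffel_disk_koszul[OF u]
    also have "2 * ?m ?\<Gamma>' (?L h) =
       frechet_derivative (\<lambda>y. metric_coeff A g d y (?L f) (?L h)) (at (loc d u)) (?L e)
     + frechet_derivative (\<lambda>y. metric_coeff A g d y (?L e) (?L h)) (at (loc d u)) (?L f)
     - frechet_derivative (\<lambda>y. metric_coeff A g d y (?L e) (?L f)) (at (loc d u)) (?L h)"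
      by (rule christoffel_koszul[OF chart(2)[OF d(1)] x])
        (use bilinear_coeff coeff_differentiable coeff_nondegenerate d x in blast)+
    ultimately show ?thesis
      using coeff_derivative_loc[OF d, of f h e] coeff_derivative_loc[OF d, of e h f]
        coeff_derivative_loc[OF d, of e f h] second_derivative_loc_commute[OF d, of h]
        second_derivative_loc_commute[OF d, of f e] coeff_commute[OF d]
      by (simp add: algebra_simps)
  qed
  have "?m (?L ?\<Gamma> - (?\<Gamma>' + ?D f e)) (?L h) = 0" for h
    using *[of h]
    by (simp add: bilinear_lsub[OF bil] bilinear_ladd[OF bil])
  from coeff_nondegenerate[OF d this] show ?thesis
    by simp
qed

text \<open>Both gradients represent the same covector \<open>l\<close>, the differential of
  \<open>\<Phi> \<circ> \<pi>\<close>: one for the Poincare form, the other for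
  \<open>\<kappa>\<close> times this form. Hence the representing vector on \<open>S\<close> is the
  image of \<open>w\<close> divided by \<open>\<kappa>\<close>.\<close>

lemma grad_push:
  assumes u: "u \<in> disk" and \<Phi>: "smooth_fun A \<Phi>"
  obtains w where "grad disk_atlas poincare_metric (\<Phi> \<circ> \<pi>) u = disk_vec w"
    "grad A g \<Phi> (\<pi> u) = push u ((1 / \<kappa>) *\<^sub>R w)"
proof -
  \<comment> \<open>The very chart that \<open>fun_diff\<close> selects, so that its value on
    \<open>push u e\<close> can be computed without a change of chart.\<close>
  define c where "c = some_chart A (\<pi> u)"
  have "\<exists>d. d \<in> charts_at A (\<pi> u)"
    using exists_chart[OF u] u in_chart_dom by blast
  then have "c \<in> charts_at A (\<pi> u)"
    unfolding c_def some_chart_def by (rule someI_ex)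
  then have c: "c \<in> A" "u \<in> chart_dom c"
    using in_chart_dom[OF u] by auto
  let ?F = "\<lambda>x. \<Phi> (chart_inv c x)"
  have "?F differentiable at (loc c u)"
    using \<Phi> c(1) loc_in_image[OF c(2)] chart(2)[OF c(1)]
    by (intro smooth_on_imp_differentiable[of _ "chart_image c"]) (auto simp: smooth_fun_def)
  then have "(?F has_derivative frechet_derivative ?F (at (loc c u))) (at (loc c u))"
    by (simp add: frechet_derivative_works)
  then have "((\<lambda>y. ?F (loc c y)) has_derivative (\<lambda>e. frechet_derivative ?F (at (loc c u)) (dloc c u e))) (at u)"
    by (rule has_derivative_compose[OF loc_has_derivative[OF c]])
  then have D: "(\<Phi> \<circ> \<pi> has_derivative (\<lambda>e. frechet_derivative ?F (at (loc c u)) (dloc c u e))) (at u)"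
    by (rule has_derivative_transform_within_open[OF _ open_chart_dom[OF c(1)] c(2)])
      (use chart_inv_apply[OF c(1)] in \<open>simp add: loc_def chart_dom_def\<close>)
  define l where "l = frechet_derivative (\<Phi> \<circ> \<pi>) (at u)"
  have l: "fun_diff A \<Phi> (\<pi> u) (push u e) = l e" for e
    using fun_cong[OF frechet_derivative_at[OF D], of e] c
    by (simp add: fun_diff_def l_def push_apply loc_def flip: c_def)
  have l_disk: "fun_diff disk_atlas (\<Phi> \<circ> \<pi>) u (disk_vec e) = l e" for e
    unfolding l_def using fun_diff_disk[OF u differentiableI[OF D]] .
  have "linear l"
    unfolding l_def frechet_derivative_at[OF D, symmetric] using D by (rule has_derivative_linear)
  have pos: "poincare_factor u > 0"
    using u by (rule poincare_factor_pos)
  have "bilinear (\<lambda>a b. poincare_factor u * (a \<bullet> b))"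
    unfolding bilinear_def by (auto intro!: linearI simp: algebra_simps)
  moreover have "w = 0" if "\<And>h. poincare_factor u * (w \<bullet> h) = 0" for w :: complex
    using that[of w] pos by simp
  ultimately have "\<exists>!w. \<forall>h. poincare_factor u * (w \<bullet> h) = l h"
    using \<open>linear l\<close> by (rule nondegenerate_form_represents_ex1)
  then obtain w where w: "\<And>h. poincare_factor u * (w \<bullet> h) = l h"
    "\<And>v. (\<And>h. poincare_factor u * (v \<bullet> h) = l h) \<Longrightarrow> v = w"
    by metis
  show thesis
  proof
    show "grad disk_atlas poincare_metric (\<Phi> \<circ> \<pi>) u = disk_vec w"
      unfolding grad_def
    proof (rule the_equality)
      show "disk_vec w \<in> tspace disk_atlas u \<and> (\<forall>h\<in>tspace disk_atlas u.
          poincare_metric u (disk_vec w) h = fun_diff disk_atlas (\<Phi> \<circ> \<pi>) u h)"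
        using w(1) by (auto simp: tspace_disk[OF u] poincare_metric_disk_vec l_disk)
      fix z assume "z \<in> tspace disk_atlas u \<and> (\<forall>h\<in>tspace disk_atlas u.
          poincare_metric u z h = fun_diff disk_atlas (\<Phi> \<circ> \<pi>) u h)"
      then obtain v where "z = disk_vec v" "\<And>h. poincare_factor u * (v \<bullet> h) = l h"
        by (auto simp: tspace_disk[OF u] poincare_metric_disk_vec l_disk)
      then show "z = disk_vec w"
        using w(2) by blast
    qed
    show "grad A g \<Phi> (\<pi> u) = push u ((1 / \<kappa>) *\<^sub>R w)"
      unfolding grad_def
    proof (rule the_equality)
      have "g (\<pi> u) (push u ((1 / \<kappa>) *\<^sub>R w)) (push u h) = l h" for h
        using w(1)[of h] \<kappa> by (simp add: g_push[OF u])
      then show "push u ((1 / \<kappa>) *\<^sub>R w) \<in> tspace A (\<pi> u) \<and> (\<forall>h\<in>tspace A (\<pi> u).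
          g (\<pi> u) (push u ((1 / \<kappa>) *\<^sub>R w)) h = fun_diff A \<Phi> (\<pi> u) h)"
        using push_in_tspace[OF u] tspace_eq_push[OF u] l by metis
      fix z assume z: "z \<in> tspace A (\<pi> u) \<and> (\<forall>h\<in>tspace A (\<pi> u). g (\<pi> u) z h = fun_diff A \<Phi> (\<pi> u) h)"
      then obtain v where v: "z = push u v"
        using tspace_eq_push[OF u] by blast
      have "poincare_factor u * ((\<kappa> *\<^sub>R v) \<bullet> h) = l h" for h
      proof -
        have "g (\<pi> u) (push u v) (push u h) = l h"
          using z push_in_tspace[OF u, of h] l[of h] unfolding v by metis
        then show ?thesis
          by (simp add: g_push[OF u] algebra_simps)
      qed
      then have "\<kappa> *\<^sub>R v = w"
        by (rule w(2))
      then show "z = push u ((1 / \<kappa>) *\<^sub>R w)"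
        using v \<kappa> by auto
    qed
  qed
qed

end

section \<open>Lifting curves\<close>

text \<open>A connected set with more than one point has no isolated points; endpoints belonging to
  \<open>I\<close> are covered as well.\<close>

lemma at_within_nondegenerate_interval:
  assumes I: "nondegenerate_interval I" and t: "t \<in> I"
  shows "at t within I \<noteq> bot"
proof -
  have "I \<noteq> {t}"
    using I by (auto simp: nondegenerate_interval_def)
  moreover have "connected I"
    using I by (simp add: nondegenerate_interval_def is_interval_connected)
  ultimately have "t islimpt I"
    using t by (auto intro: connected_imp_perfect)
  then show ?thesis
    by (simp add: trivial_limit_within)
qed

text \<open>The lift \<open>\<psi>\<close> is assumed merely continuous, as the covering property
  supplies it; its smoothness is proved below.\<close>

locale lifted_curve = poincare_homothety S A g \<pi> \<kappa>
  for S :: "'a::topological_space set" and A :: "'a chart set" and g :: "'a metric"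
    and \<pi> :: "complex \<Rightarrow> 'a" and \<kappa> :: real +
  fixes I :: "real set" and \<phi> :: "real \<Rightarrow> 'a" and \<psi> :: "real \<Rightarrow> complex"
  assumes interval: "nondegenerate_interval I"
    and smooth_\<phi>: "smooth_curve S A I \<phi>"
    and continuous_\<psi>: "continuous_on I \<psi>"
    and \<psi>_in_disk: "\<And>t. t \<in> I \<Longrightarrow> \<psi> t \<in> disk"
    and \<pi>_\<psi>: "\<And>t. t \<in> I \<Longrightarrow> \<pi> (\<psi> t) = \<phi> t"
begin

definition \<psi>' :: "real \<Rightarrow> complex" where
  "\<psi>' t = vector_derivative \<psi> (at t within I)"

definition times :: "'a chart \<Rightarrow> real set" where
  "times d = {t \<in> I. \<phi> t \<in> fst d}"

lemma nontrivial: "t \<in> I \<Longrightarrow> at t within I \<noteq> bot"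
  using interval by (rule at_within_nondegenerate_interval)

lemma times_iff: "t \<in> times d \<longleftrightarrow> t \<in> I \<and> \<psi> t \<in> chart_dom d"
  using \<psi>_in_disk \<pi>_\<psi> by (auto simp: times_def chart_dom_def)

lemma times_eq_Int_open:
  assumes d: "d \<in> A"
  obtains V where "open V" "times d = I \<inter> V"
proof -
  obtain V where "open V" "V \<inter> I = \<psi> -` chart_dom d \<inter> I"
    using continuous_\<psi> open_chart_dom[OF d] by (metis continuous_on_open_invariant)
  then show thesis
    by (intro that[of V]) (auto simp: times_iff)
qed

text \<open>\<open>smooth_curve\<close> differentiates coordinates within \<open>times d\<close>,
  but \<open>velocity\<close> differentiates within \<open>I\<close>. The two agree since
  \<open>times d\<close> is relatively open in \<open>I\<close>.\<close>

lemma at_within_times: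
  assumes d: "d \<in> A" and t: "t \<in> times d"
  shows "at t within times d = at t within I"
proof -
  obtain V where V: "open V" "times d = I \<inter> V"
    using times_eq_Int_open[OF d] .
  show ?thesis
    by (rule at_within_nhd[of t V]) (use V t in auto)
qed

lemma exists_times:
  assumes "t \<in> I"
  obtains d where "d \<in> A" "t \<in> times d"
  using exists_chart[OF \<psi>_in_disk[OF assms]] assms times_iff by blast

lemma snd_\<phi>: "t \<in> I \<Longrightarrow> snd d (\<phi> t) = loc d (\<psi> t)"
  using \<pi>_\<psi> by (simp add: loc_def)

lemma coordinate_Ck: "d \<in> A \<Longrightarrow> Ck_curve k (\<lambda>s. snd d (\<phi> s)) (times d)"
  using smooth_\<phi> by (simp add: smooth_curve_def times_def)

lemma \<psi>_has_vector_derivative: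
  assumes t: "t \<in> I"
  shows "(\<psi> has_vector_derivative \<psi>' t) (at t within I)"
proof -
  obtain d where d: "d \<in> A" "t \<in> times d"
    using exists_times[OF t] .
  then have chart_dom: "\<psi> t \<in> chart_dom d"
    by (simp add: times_iff)
  have "(\<lambda>s. snd d (\<phi> s)) differentiable (at t within I)"
    using coordinate_Ck[OF d(1), of "Suc 0"] d(2) at_within_times[OF d] by (auto simp: differentiable_on_def)
  then obtain k where k: "((\<lambda>s. snd d (\<phi> s)) has_derivative k) (at t within I)"
    by (auto simp: differentiable_def)
  then have k: "((\<lambda>s. loc d (\<psi> s)) has_derivative k) (at t within I)"
    by (rule has_derivative_transform[OF t, rotated]) (simp add: snd_\<phi>)
  \<comment> \<open>Injectivity of the differential replaces a local inverse of
    \<open>\<pi>\<close>: a linear left inverse, automatically bounded in finite dimension, suffices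
    for \<open>has_derivative_within_lift\<close>.\<close>
  obtain L' where L': "linear L'" "L' \<circ> dloc d (\<psi> t) = id"
    using linear_injective_left_inverse[OF linear_dloc[OF d(1) chart_dom] inj_dloc[OF d(1) chart_dom]] by blast
  have "(\<psi> has_derivative (\<lambda>v. L' (k v))) (at t within I)"
  proof (rule has_derivative_within_lift[OF k _ loc_has_derivative[OF d(1) chart_dom]])
    show "continuous (at t within I) \<psi>"
      using continuous_\<psi> t by (simp add: continuous_on_eq_continuous_within)
    show "bounded_linear L'"
      using L'(1) by (simp add: linear_conv_bounded_linear)
    show "L' (dloc d (\<psi> t) v) = v" for v
      using L'(2) by (metis comp_apply id_apply)
  qed
  then have "\<psi> differentiable (at t within I)"
    by (rule differentiableI)
  then show ?thesis
    by (simp add: \<psi>'_def vector_derivative_works)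
qed

lemma coordinate_has_vector_derivative:
  assumes d: "d \<in> A" "t \<in> times d"
  shows "((\<lambda>s. snd d (\<phi> s)) has_vector_derivative dloc d (\<psi> t) (\<psi>' t)) (at t within I)"
proof -
  have t: "t \<in> I" "\<psi> t \<in> chart_dom d"
    using d(2) by (auto simp: times_iff)
  have "(loc d \<circ> \<psi> has_vector_derivative dloc d (\<psi> t) (\<psi>' t)) (at t within I)"
    by (rule vector_derivative_diff_chain_within[OF \<psi>_has_vector_derivative[OF t(1)]
          has_derivative_at_withinI[OF loc_has_derivative[OF d(1) t(2)]]])
  then show ?thesis
    by (rule has_vector_derivative_transform[OF t(1), rotated]) (simp add: snd_\<phi>)
qed

section \<open>Velocities and higher regularity of the lift\<close>

lemma velocity_eq_push:
  assumes t: "t \<in> I"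
  shows "velocity A I \<phi> t = push (\<psi> t) (\<psi>' t)"
proof
  fix d
  show "velocity A I \<phi> t d = push (\<psi> t) (\<psi>' t) d"
  proof (cases "d \<in> charts_at A (\<phi> t)")
    case True
    then have d: "d \<in> A" "t \<in> times d"
      using t by (auto simp: charts_at_def times_def)
    then have "vector_derivative (\<lambda>s. snd d (\<phi> s)) (at t within I) = dloc d (\<psi> t) (\<psi>' t)"
      using vector_derivative_within[OF nontrivial[OF t]] coordinate_has_vector_derivative by blast
    then show ?thesis
      using True \<pi>_\<psi>[OF t] push_eq[OF \<psi>_in_disk[OF t]] by (simp add: velocity_def)
  next
    case False
    then show ?thesis
      using \<pi>_\<psi>[OF t] push_eq[OF \<psi>_in_disk[OF t]] by (simp add: velocity_def)
  qed
qed

lemma velocity_disk: "t \<in> I \<Longrightarrow> velocity disk_atlas I \<psi> t = disk_vec (\<psi>' t)"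
  using \<psi>_in_disk by (auto simp: velocity_def disk_vec_def \<psi>'_def)

text \<open>The coefficients are smooth for fixed vectors only, so both moving arguments are
  expanded in the basis by bilinearity.\<close>

lemma Ck_curve_coeff:
  assumes d: "d \<in> A" and J: "\<And>t. t \<in> J \<Longrightarrow> at t within J \<noteq> bot"
    and x: "Ck_curve k x J" "x ` J \<subseteq> chart_image d" and a: "Ck_curve k a J" and b: "Ck_curve k b J"
  shows "Ck_curve k (\<lambda>t. metric_coeff A g d (x t) (a t) (b t)) J"
proof -
  have m: "Ck_curve k (\<lambda>t. metric_coeff A g d (x t) i j) J" for i j
    by (rule Ck_curve_compose[OF J chart(2)[OF d] x(2) _ x(1)])
      (use smooth_coeff[OF d] in \<open>simp_all add: smooth_on_def\<close>)
  have inner: "Ck_curve k (\<lambda>t. c t \<bullet> i) J" if "Ck_curve k c J" for c :: "real \<Rightarrow> complex" and i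
    by (rule Ck_curve_bilinear[OF J bounded_bilinear_inner that Ck_curve_const[OF J]])
  have summand: "Ck_curve k (\<lambda>t. ((a t \<bullet> i) * (b t \<bullet> j)) * metric_coeff A g d (x t) i j) J" for i j
    by (rule Ck_curve_bilinear[OF J bounded_bilinear_mult
          Ck_curve_bilinear[OF J bounded_bilinear_mult inner[OF a] inner[OF b]] m])
  have "Ck_curve k (\<lambda>t. \<Sum>z\<in>Basis \<times> Basis.
      ((a t \<bullet> fst z) * (b t \<bullet> snd z)) * metric_coeff A g d (x t) (fst z) (snd z)) J"
    by (rule Ck_curve_sum[OF J _ summand]) auto
  moreover have "(\<Sum>z\<in>Basis \<times> Basis.
      ((a t \<bullet> fst z) * (b t \<bullet> snd z)) * metric_coeff A g d (x t) (fst z) (snd z))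
    = metric_coeff A g d (x t) (a t) (b t)" if "t \<in> J" for t
  proof -
    have bil: "bilinear (metric_coeff A g d (x t))"
      using bilinear_coeff[OF d] x(2) that by blast
    have "metric_coeff A g d (x t) (a t) (b t) =
        metric_coeff A g d (x t) (\<Sum>i\<in>Basis. (a t \<bullet> i) *\<^sub>R i) (\<Sum>j\<in>Basis. (b t \<bullet> j) *\<^sub>R j)"
      by (simp add: euclidean_representation)
    also have "\<dots> = (\<Sum>z\<in>Basis \<times> Basis.
      ((a t \<bullet> fst z) * (b t \<bullet> snd z)) * metric_coeff A g d (x t) (fst z) (snd z))"
      unfolding bilinear_sum[OF bil]
      by (intro sum.cong refl) (auto simp: bilinear_lmul[OF bil] bilinear_rmul[OF bil])
    finally show ?thesis
      by simp
  qed
  ultimately show ?thesis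
    by (rule Ck_curve_cong[rotated])
qed

text \<open>Since \<open>\<pi>\<close> scales the metric by \<open>\<kappa>\<close>, the components of \<open>\<psi>'\<close> are inner products of the velocity of
  \<open>\<phi>\<close> with the images of the basis vectors, so \<open>\<psi>'\<close> is as regular as \<open>\<psi>\<close>.\<close>

lemma \<psi>'_eq:
  assumes d: "d \<in> A" "t \<in> times d"
  shows "\<psi>' t = (\<Sum>e\<in>Basis. ((1 / (4 * \<kappa>)) * ((1 + (-1) * (\<psi> t \<bullet> \<psi> t)) * (1 + (-1) * (\<psi> t \<bullet> \<psi> t)))
    * metric_coeff A g d (loc d (\<psi> t)) (dloc d (\<psi> t) (\<psi>' t)) (dloc d (\<psi> t) e)) *\<^sub>R e)"
proof -
  have chart_dom: "\<psi> t \<in> chart_dom d"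
    using d(2) by (simp add: times_iff)
  \<comment> \<open>Since \<open>poincare_factor\<close> is \<open>4 / (q * q)\<close>, the
    prefactor in the statement is the reciprocal of \<open>\<kappa>\<close> times it. Writing it
    with sums and products only lets \<open>Ck_curve_add\<close> and
    \<open>Ck_curve_bilinear\<close> apply to it directly.\<close>
  define q where "q = 1 + (-1) * (\<psi> t \<bullet> \<psi> t)"
  have "(cmod (\<psi> t))\<^sup>2 < 1"
    using chart_dom_disk[OF chart_dom] abs_square_less_1[of "cmod (\<psi> t)"] by simp
  then have "q > 0" "poincare_factor (\<psi> t) = 4 / (q * q)"
    by (auto simp: q_def poincare_factor_def dot_square_norm power2_eq_square)
  then have "(1 / (4 * \<kappa>)) * (q * q) * (\<kappa> * poincare_factor (\<psi> t) * r) = r" for r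
    using \<kappa> by simp
  then show ?thesis
    unfolding coeff_dloc[OF d(1) chart_dom] q_def[symmetric] by (simp only: euclidean_representation)
qed

text \<open>A bootstrap: if \<open>\<psi>\<close> is of class \<open>k\<close>, then so is the
  right-hand side of \<open>\<psi>'_eq\<close>, and therefore \<open>\<psi>\<close> is of class
  \<open>Suc k\<close>.\<close>

lemma Ck_\<psi>_times:
  assumes d: "d \<in> A"
  shows "Ck_curve k \<psi> (times d)"
proof -
  have J: "at t within times d \<noteq> bot" if "t \<in> times d" for t
    using at_within_times[OF d that] nontrivial that by (simp add: times_iff)
  have sub: "(\<lambda>s. snd d (\<phi> s)) ` times d \<subseteq> chart_image d" "\<psi> ` times d \<subseteq> chart_dom d"
    by (force simp: times_def, force simp: times_iff)
  show ?thesis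
  proof (induction k)
    case 0
    show ?case
      using continuous_on_subset[OF continuous_\<psi>] by (auto simp: times_def)
  next
    case (Suc k)
    let ?x = "\<lambda>s. snd d (\<phi> s)"
    let ?v = "\<lambda>t. vector_derivative ?x (at t within times d)"
    let ?q = "\<lambda>t. 1 + (-1) * (\<psi> t \<bullet> \<psi> t)"
    \<comment> \<open>This removes the circularity of \<open>\<psi>'_eq\<close>: its right-hand side
      contains \<open>\<psi>'\<close> only through the coordinate velocity of \<open>\<phi>\<close>,
      whose regularity is already known.\<close>
    have v: "?v t = dloc d (\<psi> t) (\<psi>' t)" if "t \<in> times d" for t
      using vector_derivative_within[OF J[OF that]] coordinate_has_vector_derivative[OF d that]
        at_within_times[OF d that] by simp
    have "Ck_curve k ?v (times d)"
      using coordinate_Ck[OF d, of "Suc k"] by simp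
    moreover have "Ck_curve k (\<lambda>t. dloc d (\<psi> t) e) (times d)" for e
      by (rule Ck_curve_compose[OF J open_chart_dom[OF d] sub(2) _ Suc.IH])
        (use smooth_dloc[OF d] in \<open>simp_all add: smooth_on_def\<close>)
    ultimately have m: "Ck_curve k (\<lambda>t. metric_coeff A g d (?x t) (?v t) (dloc d (\<psi> t) e)) (times d)" for e
      by (intro Ck_curve_coeff[OF d J coordinate_Ck[OF d] sub(1)])
    have q: "Ck_curve k ?q (times d)"
      by (intro Ck_curve_add[OF J] Ck_curve_bilinear[OF J bounded_bilinear_mult]
          Ck_curve_bilinear[OF J bounded_bilinear_inner] Ck_curve_const[OF J] Suc.IH)
    have "Ck_curve k (\<lambda>t. \<Sum>e\<in>Basis. ((1 / (4 * \<kappa>)) * (?q t * ?q t)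
        * metric_coeff A g d (?x t) (?v t) (dloc d (\<psi> t) e)) *\<^sub>R e) (times d)"
      by (intro Ck_curve_sum[OF J] finite_Basis Ck_curve_bilinear[OF J bounded_bilinear_scaleR]
          Ck_curve_bilinear[OF J bounded_bilinear_mult] Ck_curve_const[OF J] m q)
    then have "Ck_curve k \<psi>' (times d)"
      by (rule Ck_curve_cong[rotated]) (use \<psi>'_eq[OF d] v snd_\<phi> in \<open>simp add: times_iff\<close>)
    moreover have "(\<psi> has_vector_derivative \<psi>' t) (at t within times d)" if "t \<in> times d" for t
      using at_within_times[OF d that] \<psi>_has_vector_derivative that by (simp add: times_iff)
    ultimately show ?case
      using Ck_curve_Suc_iff[OF J] by blast
  qed
qed

lemma Ck_\<psi>: "Ck_curve k \<psi> I"
proof (rule Ck_curve_local)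
  fix t assume "t \<in> I"
  then obtain d where d: "d \<in> A" "t \<in> times d"
    by (rule exists_times)
  obtain V where V: "open V" "times d = I \<inter> V"
    using times_eq_Int_open[OF d(1)] .
  then show "\<exists>V. open V \<and> t \<in> V \<and> Ck_curve k \<psi> (I \<inter> V)"
    using d Ck_\<psi>_times[OF d(1), of k] by (intro exI[of _ V]) auto
qed

lemma smooth_\<psi>: "smooth_curve disk disk_atlas I \<psi>"
proof -
  have "{t \<in> I. \<psi> t \<in> disk} = I"
    using \<psi>_in_disk by blast
  then show ?thesis
    unfolding smooth_curve_def disk_atlas_def disk_chart_def
    using continuous_\<psi> \<psi>_in_disk Ck_\<psi> by auto
qed

text \<open>The product rule for \<open>dloc d (\<psi> s) (\<psi>' s)\<close> yields the image of
  the second derivative of \<open>\<psi>\<close> plus the term \<open>?D\<close>; \<open>?D\<close>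
  is exactly the inhomogeneous term of \<open>christoffel_loc\<close>, which absorbs it.\<close>

lemma cov_deriv_eq_dloc:
  assumes d: "d \<in> A" "t \<in> times d"
  shows "cov_deriv A g I \<phi> (velocity A I \<phi>) t d =
    dloc d (\<psi> t) (cov_deriv disk_atlas poincare_metric I \<psi> (velocity disk_atlas I \<psi>) t disk_chart)"
proof -
  have t: "t \<in> I" "\<psi> t \<in> chart_dom d" "d \<in> charts_at A (\<phi> t)"
    using d times_iff[of t d] by (auto simp: times_def charts_at_def)
  let ?\<psi>'' = "vector_derivative \<psi>' (at t within I)"
  let ?D = "frechet_derivative (\<lambda>y. dloc d y (\<psi>' t)) (at (\<psi> t)) (\<psi>' t)"
  let ?\<Gamma> = "christoffel disk_atlas poincare_metric disk_chart (\<psi> t) (\<psi>' t) (\<psi>' t)"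
  have "\<psi>' differentiable (at t within I)"
    using Ck_\<psi>[of "Suc (Suc 0)"] t(1) by (simp add: differentiable_on_def \<psi>'_def[abs_def])
  then have "(\<psi>' has_vector_derivative ?\<psi>'') (at t within I)"
    by (simp add: vector_derivative_works)
  then have "((\<lambda>s. dloc d (\<psi> s) (\<psi>' s)) has_derivative
      (\<lambda>h. frechet_derivative (\<lambda>y. dloc d y (\<psi>' t)) (at (\<psi> t)) (h *\<^sub>R \<psi>' t)
        + dloc d (\<psi> t) (h *\<^sub>R ?\<psi>''))) (at t within I)"
    using \<psi>_has_vector_derivative[OF t(1)] unfolding has_vector_derivative_def
    by (intro has_derivative_linear_family[where L="dloc d" and p=\<psi> and U="chart_dom d",
          OF open_chart_dom[OF d(1)] t(2) linear_dloc[OF d(1)]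
            differentiableI[OF dloc_has_derivative[OF d(1) t(2)]] _ _ t(1)])
  moreover have "linear (frechet_derivative (\<lambda>y. dloc d y (\<psi>' t)) (at (\<psi> t)))" "linear (dloc d (\<psi> t))"
    using has_derivative_linear dloc_has_derivative[OF d(1) t(2)] linear_dloc[OF d(1) t(2)] by blast+
  ultimately have der: "((\<lambda>s. dloc d (\<psi> s) (\<psi>' s)) has_vector_derivative
      ?D + dloc d (\<psi> t) ?\<psi>'') (at t within I)"
    by (simp add: has_vector_derivative_def linear_cmul scaleR_add_right)
  have vel: "velocity A I \<phi> s d = dloc d (\<psi> s) (\<psi>' s)" if "s \<in> times d" for s
    using that velocity_eq_push push_apply[OF d(1)] by (simp add: times_iff)
  obtain V where V: "open V" "times d = I \<inter> V"
    using times_eq_Int_open[OF d(1)] .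
  \<comment> \<open>The formula for the velocity holds only while the curve is in the chart
    \<open>d\<close>; at other times its component is 0 by convention. Agreement near
    \<open>t\<close> is enough for the derivative at \<open>t\<close>.\<close>
  have "eventually (\<lambda>s. s \<in> V) (nhds t)"
    using V d(2) by (intro eventually_nhds_in_open) auto
  then have "eventually (\<lambda>s. s \<in> I \<longrightarrow> velocity A I \<phi> s d = dloc d (\<psi> s) (\<psi>' s)) (nhds t)"
    by eventually_elim (use V vel in auto)
  then have "vector_derivative (\<lambda>s. velocity A I \<phi> s d) (at t within I)
      = vector_derivative (\<lambda>s. dloc d (\<psi> s) (\<psi>' s)) (at t within I)"
    using t(1) by (intro vector_derivative_cong_eq) auto
  also have "\<dots> = ?D + dloc d (\<psi> t) ?\<psi>''"
    using nontrivial[OF t(1)] der by (rule vector_derivative_within)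
  finally have "cov_deriv A g I \<phi> (velocity A I \<phi>) t d = (?D + dloc d (\<psi> t) ?\<psi>'')
      + christoffel A g d (loc d (\<psi> t)) (dloc d (\<psi> t) (\<psi>' t)) (dloc d (\<psi> t) (\<psi>' t))"
    using t(3) vel[OF d(2)] snd_\<phi>[OF t(1)] by (simp add: cov_deriv_def)
  also have "\<dots> = dloc d (\<psi> t) (?\<psi>'' + ?\<Gamma>)"
    unfolding linear_add[OF linear_dloc[OF d(1) t(2)]] christoffel_loc[OF d(1) t(2)] by simp
  also have "?\<psi>'' + ?\<Gamma> =
      cov_deriv disk_atlas poincare_metric I \<psi> (velocity disk_atlas I \<psi>) t disk_chart"
  proof -
    have "vector_derivative (\<lambda>s. velocity disk_atlas I \<psi> s disk_chart) (at t within I) = ?\<psi>''"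
      using t(1) by (intro vector_derivative_cong_eq always_eventually) (auto simp: velocity_disk)
    then show ?thesis
      using \<psi>_in_disk[OF t(1)] t(1) by (simp add: cov_deriv_def velocity_disk)
  qed
  finally show ?thesis .
qed

section \<open>Transfer of the equation to the lift\<close>

lemma tnorm_velocity:
  assumes t: "t \<in> I"
  shows "(tnorm g (\<phi> t) (velocity A I \<phi> t))\<^sup>2
    = \<kappa> * (tnorm poincare_metric (\<psi> t) (velocity disk_atlas I \<psi> t))\<^sup>2"
proof -
  have "g (\<phi> t) (velocity A I \<phi> t) (velocity A I \<phi> t) = \<kappa> * poincare_factor (\<psi> t) * (\<psi>' t \<bullet> \<psi>' t)"
    using g_push[OF \<psi>_in_disk[OF t]] \<pi>_\<psi>[OF t] by (simp add: velocity_eq_push[OF t])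
  then show ?thesis
    using \<kappa> poincare_factor_pos[OF \<psi>_in_disk[OF t]]
    by (simp add: tnorm_def velocity_disk[OF t] poincare_metric_disk_vec)
qed

text \<open>At a fixed time the friction factor is just a number \<open>r\<close>, so the left-hand
  side is a linear combination of vectors. Its image under the injective \<open>dloc\<close>
  vanishes in one chart, and this is already enough.\<close>

lemma lifted_equation:
  assumes t: "t \<in> I" and \<Phi>: "smooth_fun A \<Phi>"
    and eq: "\<And>c. cov_deriv A g I \<phi> (velocity A I \<phi>) t c + r *\<^sub>R velocity A I \<phi> t c + grad A g \<Phi> (\<phi> t) c = 0"
  shows "cov_deriv disk_atlas poincare_metric I \<psi> (velocity disk_atlas I \<psi>) t c
    + r *\<^sub>R velocity disk_atlas I \<psi> t c
    + (1 / \<kappa>) *\<^sub>R grad disk_atlas poincare_metric (\<Phi> \<circ> \<pi>) (\<psi> t) c = 0"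
proof -
  obtain w where w: "grad disk_atlas poincare_metric (\<Phi> \<circ> \<pi>) (\<psi> t) = disk_vec w"
    "grad A g \<Phi> (\<phi> t) = push (\<psi> t) ((1 / \<kappa>) *\<^sub>R w)"
    using grad_push[OF \<psi>_in_disk[OF t] \<Phi>] \<pi>_\<psi>[OF t] by metis
  show ?thesis
  proof (cases "c = disk_chart")
    case True
    obtain d where d: "d \<in> A" "t \<in> times d"
      using exists_times[OF t] .
    then have chart_dom: "\<psi> t \<in> chart_dom d"
      by (simp add: times_iff)
    let ?C = "cov_deriv disk_atlas poincare_metric I \<psi> (velocity disk_atlas I \<psi>) t disk_chart"
    note lin = linear_dloc[OF d(1) chart_dom]
    have "dloc d (\<psi> t) (?C + r *\<^sub>R \<psi>' t + (1 / \<kappa>) *\<^sub>R w) =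
        dloc d (\<psi> t) ?C + r *\<^sub>R dloc d (\<psi> t) (\<psi>' t) + dloc d (\<psi> t) ((1 / \<kappa>) *\<^sub>R w)"
      by (simp only: linear_add[OF lin] linear_cmul[OF lin])
    also have "\<dots> = 0"
      using eq[of d] by (simp only: cov_deriv_eq_dloc[OF d] velocity_eq_push[OF t] w(2) push_apply[OF d(1) chart_dom])
    finally have "?C + r *\<^sub>R \<psi>' t + (1 / \<kappa>) *\<^sub>R w = 0"
      by (rule dloc_eq_0[OF d(1) chart_dom])
    then show ?thesis
      using True by (simp add: w(1) velocity_disk[OF t])
  next
    \<comment> \<open>On every chart other than the disk chart all three terms are 0 by
      convention.\<close>
    case False
    then show ?thesis
      using \<psi>_in_disk[OF t] by (simp add: w(1) velocity_disk[OF t] cov_deriv_def disk_vec_def)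
  qed
qed

end

theorem mainTheorem1:
  fixes S :: "'a::topological_space set" and A :: "'a chart set" and G \<G> :: "'a metric"
    and \<alpha> M :: real and \<Phi> :: "'a \<Rightarrow> real"
    and \<Delta> :: "(complex \<Rightarrow> complex) set" and \<pi> :: "complex \<Rightarrow> 'a"
    and I :: "real set" and t0 :: real and \<phi>0 :: 'a and v0 :: "'a tvec" and \<phi> :: "real \<Rightarrow> 'a"
    and u0 :: complex and w0 :: "complex tvec"
  assumes "hyperbolic_surface S A G" and "geometrically_finite S"
    and "\<alpha> > 0" and "M > 0"
    and "\<G> = (\<lambda>p v w. 3 * \<alpha> * G p v w)"
    and "smooth_fun A \<Phi>"
    and "uniformization S A G \<Delta> \<pi>"
    and "t0 \<in> I" and "\<phi>0 \<in> S" and "v0 \<in> tspace A \<phi>0"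
    and "maximal_cosmological_solution S A \<G> M \<Phi> I \<phi>"
    and "\<phi> t0 = \<phi>0" and "velocity A I \<phi> t0 = v0"
    and "u0 \<in> disk" and "\<pi> u0 = \<phi>0"
    and "w0 \<in> tspace disk_atlas u0" and "map_diff disk_atlas A \<pi> u0 w0 = v0"
  shows "\<exists>\<psi> :: real \<Rightarrow> complex.
    smooth_curve disk disk_atlas I \<psi> \<and>
    (\<forall>t\<in>I. \<phi> t = \<pi> (\<psi> t)) \<and>
    (\<forall>t\<in>I. 3 * \<alpha> * (tnorm poincare_metric (\<psi> t) (velocity disk_atlas I \<psi> t))\<^sup>2
       + 2 * (\<Phi> \<circ> \<pi>) (\<psi> t) > 0) \<and>
    (\<forall>t\<in>I. \<forall>c.
       cov_deriv disk_atlas poincare_metric I \<psi> (velocity disk_atlas I \<psi>) t c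
       + (1 / M * sqrt (3 / 2) *
            sqrt (3 * \<alpha> * (tnorm poincare_metric (\<psi> t) (velocity disk_atlas I \<psi> t))\<^sup>2
                  + 2 * (\<Phi> \<circ> \<pi>) (\<psi> t))) *\<^sub>R velocity disk_atlas I \<psi> t c
       + (1 / (3 * \<alpha>)) *\<^sub>R grad disk_atlas poincare_metric (\<Phi> \<circ> \<pi>) (\<psi> t) c = 0) \<and>
    \<psi> t0 = u0 \<and> velocity disk_atlas I \<psi> t0 = w0"
proof -
  have sol: "cosmological_solution S A \<G> M \<Phi> I \<phi>"
    using assms(11) by (simp add: maximal_cosmological_solution_def)
  then have I: "nondegenerate_interval I" and \<phi>: "smooth_curve S A I \<phi>"
    by (auto simp: cosmological_solution_def)
  have cov: "covering_space disk \<pi> S" and iso: "local_isometry disk disk_atlas poincare_metric S A G \<pi>"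
    using assms(7) by (auto simp: uniformization_def)
  have atlas: "oriented_atlas S A" and metric: "riemannian_metric S A G"
    using assms(1) by (auto simp: hyperbolic_surface_def surface_def)
  obtain \<psi> where \<psi>: "continuous_on I \<psi>" "\<psi> \<in> I \<rightarrow> disk" "\<psi> t0 = u0" "\<And>t. t \<in> I \<Longrightarrow> \<pi> (\<psi> t) = \<phi> t"
  proof (rule covering_space_lift_interval[OF cov, of I t0 \<phi> u0])
    show "is_interval I"
      using I by (simp add: nondegenerate_interval_def)
    show "continuous_on I \<phi>" "\<phi> \<in> I \<rightarrow> S"
      using \<phi> by (auto simp: smooth_curve_def)
  qed (use assms in auto)
  interpret lifted_curve S A \<G> \<pi> "3 * \<alpha>" I \<phi> \<psi>
  proof
    show "oriented_atlas S A"
      by (rule atlas)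
    show "smooth_map disk disk_atlas S A \<pi>"
      using iso by (simp add: local_isometry_def)
    show "\<pi> ` disk = S"
      using cov by (rule covering_space_imp_surjective)
    show "smooth_on (\<lambda>x. metric_coeff A \<G> c x a b) (chart_image c)" if "c \<in> A" for c a b
    proof -
      have "open (chart_image c)" "smooth_on (\<lambda>x. metric_coeff A G c x a b) (chart_image c)"
        using atlas metric that by (auto simp: oriented_atlas_def riemannian_metric_def)
      then show ?thesis
        unfolding assms(5) metric_coeff_def by (rule smooth_on_cmult)
    qed
    show "3 * \<alpha> > 0"
      using assms(3) by simp
    show "\<G> (\<pi> u) (map_diff disk_atlas A \<pi> u v) (map_diff disk_atlas A \<pi> u w)
        = 3 * \<alpha> * poincare_metric u v w"
      if "u \<in> disk" "v \<in> tspace disk_atlas u" "w \<in> tspace disk_atlas u" for u v w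
      using iso that unfolding assms(5) by (simp add: local_isometry_def)
  qed (use I \<phi> \<psi> in auto)
  \<comment> \<open>The rescaling turns the squared speed on \<open>S\<close> into
    \<open>3 * \<alpha>\<close> times the one on the disk. Hence both equations carry the same
    friction factor, which \<open>lifted_equation\<close> requires of its \<open>r\<close>, and
    positivity of the radicand is inherited.\<close>
  have radicand: "(tnorm \<G> (\<phi> t) (velocity A I \<phi> t))\<^sup>2 + 2 * \<Phi> (\<phi> t)
      = 3 * \<alpha> * (tnorm poincare_metric (\<psi> t) (velocity disk_atlas I \<psi> t))\<^sup>2 + 2 * (\<Phi> \<circ> \<pi>) (\<psi> t)"
    if "t \<in> I" for t
    using tnorm_velocity[OF that] \<pi>_\<psi>[OF that] by simp
  show ?thesis
  proof (intro exI[of _ \<psi>] conjI ballI allI)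
    show "smooth_curve disk disk_atlas I \<psi>"
      by (rule smooth_\<psi>)
    show "\<phi> t = \<pi> (\<psi> t)" if "t \<in> I" for t
      using \<pi>_\<psi>[OF that] ..
    show "3 * \<alpha> * (tnorm poincare_metric (\<psi> t) (velocity disk_atlas I \<psi> t))\<^sup>2
       + 2 * (\<Phi> \<circ> \<pi>) (\<psi> t) > 0" if "t \<in> I" for t
      using sol that unfolding cosmological_solution_def radicand[OF that, symmetric] by blast
    show "cov_deriv disk_atlas poincare_metric I \<psi> (velocity disk_atlas I \<psi>) t c
       + (1 / M * sqrt (3 / 2) *
            sqrt (3 * \<alpha> * (tnorm poincare_metric (\<psi> t) (velocity disk_atlas I \<psi> t))\<^sup>2
                  + 2 * (\<Phi> \<circ> \<pi>) (\<psi> t))) *\<^sub>R velocity disk_atlas I \<psi> t c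
       + (1 / (3 * \<alpha>)) *\<^sub>R grad disk_atlas poincare_metric (\<Phi> \<circ> \<pi>) (\<psi> t) c = 0" if "t \<in> I" for t c
    proof (rule lifted_equation[OF that assms(6)])
      show "cov_deriv A \<G> I \<phi> (velocity A I \<phi>) t d
       + (1 / M * sqrt (3 / 2) *
            sqrt (3 * \<alpha> * (tnorm poincare_metric (\<psi> t) (velocity disk_atlas I \<psi> t))\<^sup>2
                  + 2 * (\<Phi> \<circ> \<pi>) (\<psi> t))) *\<^sub>R velocity A I \<phi> t d
       + grad A \<G> \<Phi> (\<phi> t) d = 0" for d
        using sol that unfolding cosmological_solution_def radicand[OF that, symmetric] by blast
    qed
    show "\<psi> t0 = u0"
      by (rule \<psi>(3))
    obtain e where e: "w0 = disk_vec e"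
      using assms(14,16) tspace_disk by blast
    \<comment> \<open>The differential of \<open>\<pi>\<close> sends both the initial velocity of
      the lift and the prescribed vector \<open>w0\<close> to \<open>v0\<close>, so its injectivity
      identifies them.\<close>
    have "push u0 (\<psi>' t0) = push u0 e"
      using assms(13,17) velocity_eq_push[OF assms(8)] by (simp add: push_def e \<psi>(3))
    then have "\<psi>' t0 = e"
      using push_inject[OF assms(14)] by blast
    then show "velocity disk_atlas I \<psi> t0 = w0"
      by (simp add: velocity_disk[OF assms(8)] e)
  qed
qed

end
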